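(* The isomorphism relation for countable linear orders is Borel reducible to the conjugacy relation on $\mathrm{Aut}(\infty\mathbin{\hat{*}} I_\infty)$. Hence the conjugacy relation on $\mathrm{Aut}(\infty\mathbin{\hat{*}} I_\infty)$ is Borel complete.
   Context: A digraph is a set with an irreflexive asymmetric edge relation $\to$; $x\perp y$ means no edge between $x,y$. A digraph is complete multipartite if $\perp$ (taken reflexively) is an equivalence relation; its classes are the maximal antichains. Let $\mathcal C$ be the class of finite complete multipartite digraphs with the parity property: for every two distinct maximal antichains $A,B$, distinct $a,a'\in A$ and distinct $b,b'\in B$, there is an even number of edges pointing from $\{a,a'\}$ to $\{b,b'\}$. $\mathcal C$ is an amalgamation class, and $\infty\mathbin{\hat{*}} I_\infty$ denotes its Fraïssé limit (the semigeneric complete multipartite digraph), a countable homogeneous digraph. $\mathrm{Aut}(\infty\mathbin{\hat{*}} I_\infty)$ is a Polish group; conjugacy: $\phi\sim\psi$ iff $\alpha\phi\alpha^{-1}=\psi$ for some automorphism $\alpha$. Borel reducibility: $E\le_B F$ if there is a Borel $f$ with $x\mathrel{E}x'\iff f(x)\mathrel{F}f(x')$. Borel complete: reducible to the isomorphism relation on some class of countable structures (coded on $\mathbb N$), and the isomorphism relation on every class of countable structures is Borel reducible to it. *)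

theory Defs
  imports "HOL-Analysis.Analysis"
begin

definition digraph :: "'a set \<Rightarrow> ('a \<Rightarrow> 'a \<Rightarrow> bool) \<Rightarrow> bool" where
  "digraph V E \<longleftrightarrow> (\<forall>x\<in>V. \<not> E x x) \<and> (\<forall>x\<in>V. \<forall>y\<in>V. E x y \<longrightarrow> \<not> E y x)"

definition perp :: "('a \<Rightarrow> 'a \<Rightarrow> bool) \<Rightarrow> 'a \<Rightarrow> 'a \<Rightarrow> bool" where
  "perp E x y \<longleftrightarrow> \<not> E x y \<and> \<not> E y x"

text \<open>Complete multipartite: reflexive perp (automatic by irreflexivity, symmetric by
  definition) is an equivalence relation on V, i.e. transitive.\<close>
definition complete_multipartite :: "'a set \<Rightarrow> ('a \<Rightarrow> 'a \<Rightarrow> bool) \<Rightarrow> bool" where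
  "complete_multipartite V E \<longleftrightarrow> digraph V E \<and>
     (\<forall>x\<in>V. \<forall>y\<in>V. \<forall>z\<in>V. perp E x y \<and> perp E y z \<longrightarrow> perp E x z)"

text \<open>Parity property: a, a' distinct in one maximal antichain (perp-class), b, b' distinct in
  a different one (a, b not perp); the number of edges from {a,a'} to {b,b'} is even.\<close>
definition parity_property :: "'a set \<Rightarrow> ('a \<Rightarrow> 'a \<Rightarrow> bool) \<Rightarrow> bool" where
  "parity_property V E \<longleftrightarrow>
     (\<forall>a\<in>V. \<forall>a'\<in>V. \<forall>b\<in>V. \<forall>b'\<in>V.
        a \<noteq> a' \<and> b \<noteq> b' \<and> perp E a a' \<and> perp E b b' \<and> \<not> perp E a b \<longrightarrow>
        even (card {(x, y). x \<in> {a, a'} \<and> y \<in> {b, b'} \<and> E x y}))"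

definition class_C :: "'a set \<Rightarrow> ('a \<Rightarrow> 'a \<Rightarrow> bool) \<Rightarrow> bool" where
  "class_C V E \<longleftrightarrow> finite V \<and> complete_multipartite V E \<and> parity_property V E"

definition automorphism :: "(nat \<Rightarrow> nat \<Rightarrow> bool) \<Rightarrow> (nat \<Rightarrow> nat) \<Rightarrow> bool" where
  "automorphism G \<sigma> \<longleftrightarrow> bij \<sigma> \<and> (\<forall>x y. G x y \<longleftrightarrow> G (\<sigma> x) (\<sigma> y))"

text \<open>G (on vertex set nat) is the Fraisse limit of C: a countable homogeneous digraph whose
  age is exactly C (up to isomorphism). By Fraisse's theorem it is unique up to isomorphism.\<close>
definition semigeneric_limit :: "(nat \<Rightarrow> nat \<Rightarrow> bool) \<Rightarrow> bool" where
  "semigeneric_limit G \<longleftrightarrow>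
     digraph UNIV G \<and>
     (\<forall>V. finite V \<longrightarrow> class_C V G) \<and>
     (\<forall>(V :: nat set) E. class_C V E \<longrightarrow>
        (\<exists>f. inj_on f V \<and> (\<forall>x\<in>V. \<forall>y\<in>V. E x y \<longleftrightarrow> G (f x) (f y)))) \<and>
     (\<forall>A p. finite A \<and> inj_on p A \<and> (\<forall>x\<in>A. \<forall>y\<in>A. G x y \<longleftrightarrow> G (p x) (p y)) \<longrightarrow>
        (\<exists>\<sigma>. automorphism G \<sigma> \<and> (\<forall>x\<in>A. \<sigma> x = p x)))"

definition conjugate :: "(nat \<Rightarrow> nat \<Rightarrow> bool) \<Rightarrow> (nat \<Rightarrow> nat) \<Rightarrow> (nat \<Rightarrow> nat) \<Rightarrow> bool" where
  "conjugate G \<phi> \<psi> \<longleftrightarrow> (\<exists>\<alpha>. automorphism G \<alpha> \<and> \<alpha> \<circ> \<phi> \<circ> inv \<alpha> = \<psi>)"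

text \<open>Aut(G) with the Borel sigma-algebra of its Polish (pointwise convergence) topology,
  i.e. the trace of the product sigma-algebra of Baire space nat^nat.\<close>
definition Aut_space :: "(nat \<Rightarrow> nat \<Rightarrow> bool) \<Rightarrow> (nat \<Rightarrow> nat) measure" where
  "Aut_space G = restrict_space (Pi\<^sub>M UNIV (\<lambda>_. count_space UNIV)) {\<sigma>. automorphism G \<sigma>}"

definition borel_reducible ::
  "'a measure \<Rightarrow> ('a \<Rightarrow> 'a \<Rightarrow> bool) \<Rightarrow> 'b measure \<Rightarrow> ('b \<Rightarrow> 'b \<Rightarrow> bool) \<Rightarrow> bool" where
  "borel_reducible M E N F \<longleftrightarrow>
     (\<exists>f \<in> measurable M N. \<forall>x\<in>space M. \<forall>y\<in>space M. E x y \<longleftrightarrow> F (f x) (f y))"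

definition linear_orders :: "(nat \<times> nat \<Rightarrow> bool) set" where
  "linear_orders = {R. (\<forall>x. \<not> R (x, x)) \<and> (\<forall>x y z. R (x, y) \<and> R (y, z) \<longrightarrow> R (x, z))
                      \<and> (\<forall>x y. x \<noteq> y \<longrightarrow> R (x, y) \<or> R (y, x))}"

definition LO_space :: "(nat \<times> nat \<Rightarrow> bool) measure" where
  "LO_space = restrict_space (Pi\<^sub>M UNIV (\<lambda>_. count_space UNIV)) linear_orders"

definition LO_iso :: "(nat \<times> nat \<Rightarrow> bool) \<Rightarrow> (nat \<times> nat \<Rightarrow> bool) \<Rightarrow> bool" where
  "LO_iso R S \<longleftrightarrow> (\<exists>\<pi>. bij \<pi> \<and> (\<forall>x y. R (x, y) \<longleftrightarrow> S (\<pi> x, \<pi> y)))"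

text \<open>A countable relational language is given by an arity function on symbols nat
  (finite languages are padded with symbols interpreted trivially). A structure on nat
  is a set of pairs (symbol, tuple) with tuples of the right length.\<close>
definition structures :: "(nat \<Rightarrow> nat) \<Rightarrow> (nat \<times> nat list \<Rightarrow> bool) set" where
  "structures ar = {M. \<forall>i xs. M (i, xs) \<longrightarrow> length xs = ar i}"

definition str_measure :: "(nat \<times> nat list \<Rightarrow> bool) measure" where
  "str_measure = Pi\<^sub>M UNIV (\<lambda>_. count_space UNIV)"

definition str_iso :: "(nat \<times> nat list \<Rightarrow> bool) \<Rightarrow> (nat \<times> nat list \<Rightarrow> bool) \<Rightarrow> bool" where
  "str_iso M N \<longleftrightarrow> (\<exists>\<pi>. bij \<pi> \<and> (\<forall>i xs. M (i, xs) \<longleftrightarrow> N (i, map \<pi> xs)))"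

definition structure_class :: "(nat \<Rightarrow> nat) \<Rightarrow> (nat \<times> nat list \<Rightarrow> bool) set \<Rightarrow> bool" where
  "structure_class ar K \<longleftrightarrow> K \<subseteq> structures ar \<and> K \<in> sets str_measure \<and>
     (\<forall>M\<in>K. \<forall>N\<in>structures ar. str_iso M N \<longrightarrow> N \<in> K)"

definition borel_complete :: "'b measure \<Rightarrow> ('b \<Rightarrow> 'b \<Rightarrow> bool) \<Rightarrow> bool" where
  "borel_complete N F \<longleftrightarrow>
     (\<exists>ar K. structure_class ar K \<and>
        borel_reducible N F (restrict_space str_measure K) str_iso) \<and>
     (\<forall>ar K. structure_class ar K \<longrightarrow>
        borel_reducible (restrict_space str_measure K) str_iso N F)"

end

theory Submission
  imports Defs
begin

text \<open>
  Every countable tournament \<open>T\<close> is the set of fixed points of an automorphism of the semigeneric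
  digraph, canonically enough that isomorphism of tournaments becomes conjugacy of automorphisms.
  By parity, a semigeneric digraph amounts to a tournament on its parts together with, for
  every vertex \<open>a\<close> and every other part \<open>i\<close>, a bit; the edge between \<open>a\<close> and \<open>b\<close> is the sum
  modulo 2 of the orientation of their parts and the two bits.  Over \<open>T\<close> one freely adds parts
  given by finite lists of vertices and vertices given by finite lists of parts, each tagged by
  an integer.  The result is functorial in \<open>T\<close> and has the extension property, and the tag shift
  is an automorphism that fixes exactly \<open>T\<close>.  A back-and-forth with least witnesses identifies it
  with the given limit in a Borel way.

  Linear orders are tournaments.  An arbitrary countable structure is first pulled back along the
  colouring of a generic coloured tournament on the natural numbers.  All finite tuples of the
  pulled back structure then carry a canonical orientation, and rigid markers
  code the relations, so the structure is encoded by a tournament.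
\<close>

section \<open>Back-and-forth with measurable choices\<close>

text \<open>Taking the witness with the least code makes the choice a measurable function of
  \<open>P\<close>, which an arbitrary choice need not be.\<close>

definition forth_step ::
    "(('a::countable \<times> 'b::countable) list \<Rightarrow> bool) \<Rightarrow> nat \<Rightarrow> ('a \<times> 'b) list \<Rightarrow> ('a \<times> 'b) list" where
  "forth_step P n s = (from_nat n, from_nat (LEAST m. P ((from_nat n, from_nat m) # s))) # s"

definition back_step ::
    "(('a::countable \<times> 'b::countable) list \<Rightarrow> bool) \<Rightarrow> nat \<Rightarrow> ('a \<times> 'b) list \<Rightarrow> ('a \<times> 'b) list" where
  "back_step P n s = (from_nat (LEAST m. P ((from_nat m, from_nat n) # s)), from_nat n) # s"

primrec back_forth ::
    "(('a::countable \<times> 'b::countable) list \<Rightarrow> bool) \<Rightarrow> nat \<Rightarrow> ('a \<times> 'b) list" where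
  "back_forth P 0 = []"
| "back_forth P (Suc n) = back_step P n (forth_step P n (back_forth P n))"

text \<open>Finite lists over countable types form a countable type, so the next step can be
  composed with a stage by treating each of the countably many values of the stage
  separately.\<close>

lemma measurable_back_forth:
  fixes P :: "'p \<Rightarrow> ('a::countable \<times> 'b::countable) list \<Rightarrow> bool"
  assumes meas: "\<And>s. (\<lambda>p. P p s) \<in> measurable M (count_space UNIV)"
  shows "(\<lambda>p. back_forth (P p) n) \<in> measurable M (count_space UNIV)"
proof (induction n)
  case 0
  show ?case by simp
next
  case (Suc n)
  have f: "(\<lambda>p. forth_step (P p) n s) \<in> measurable M (count_space UNIV)" for s
  proof -
    have "(\<lambda>p. LEAST m. P p ((from_nat n, from_nat m) # s)) \<in> measurable M (count_space UNIV)"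
      by (intro measurable_Least meas)
    then show ?thesis
      unfolding forth_step_def by (rule measurable_compose) simp
  qed
  have b: "(\<lambda>p. back_step (P p) n s) \<in> measurable M (count_space UNIV)" for s
  proof -
    have "(\<lambda>p. LEAST m. P p ((from_nat m, from_nat n) # s)) \<in> measurable M (count_space UNIV)"
      by (intro measurable_Least meas)
    then show ?thesis
      unfolding back_step_def by (rule measurable_compose) simp
  qed
  have "(\<lambda>p. forth_step (P p) n (back_forth (P p) n)) \<in> measurable M (count_space UNIV)"
    by (rule measurable_compose_countable[OF f Suc.IH])
  then show ?case
    unfolding back_forth.simps by (rule measurable_compose_countable[OF b])
qed

text \<open>Each value of the limit map is read off one finite stage, hence depends measurably on
  the parameter. Since the stages increase, any two values lie in a common good list, which is
  enough to transfer binary relations.\<close>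

lemma measurable_back_and_forth:
  fixes P :: "'p \<Rightarrow> ('a::countable \<times> 'b::countable) list \<Rightarrow> bool"
  assumes meas: "\<And>s. (\<lambda>p. P p s) \<in> measurable M (count_space UNIV)"
    and Nil: "\<And>p. p \<in> space M \<Longrightarrow> P p []"
    and forward: "\<And>p s x. p \<in> space M \<Longrightarrow> P p s \<Longrightarrow> \<exists>y. P p ((x, y) # s)"
    and backward: "\<And>p s y. p \<in> space M \<Longrightarrow> P p s \<Longrightarrow> \<exists>x. P p ((x, y) # s)"
    and inj: "\<And>p s x y x' y'. p \<in> space M \<Longrightarrow> P p s \<Longrightarrow> (x, y) \<in> set s \<Longrightarrow> (x', y') \<in> set s \<Longrightarrow>
      x = x' \<longleftrightarrow> y = y'"
  shows "\<exists>f. (\<forall>x. (\<lambda>p. f p x) \<in> measurable M (count_space UNIV)) \<and>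
    (\<forall>p\<in>space M. bij (f p) \<and>
      (\<forall>x y. \<exists>s. P p s \<and> (x, f p x) \<in> set s \<and> (y, f p y) \<in> set s))"
proof -
  \<comment> \<open>Stage \<open>Suc (to_nat x)\<close> has already treated \<open>x\<close>. The
    \<open>SOME\<close> is harmless: it is applied to a stage, which ranges over a countable
    discrete space, where every function is measurable.\<close>
  define f where "f p x = (SOME y. (x, y) \<in> set (back_forth (P p) (Suc (to_nat x))))" for p x
  have "(\<lambda>p. f p x) \<in> measurable M (count_space UNIV)" for x
    unfolding f_def
    by (rule measurable_compose[OF measurable_back_forth[OF meas]]) simp
  moreover have "bij (f p) \<and> (\<forall>x y. \<exists>s. P p s \<and> (x, f p x) \<in> set s \<and> (y, f p y) \<in> set s)"
    if p: "p \<in> space M" for p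
  proof -
    let ?B = "back_forth (P p)"
    have fs: "P p (forth_step (P p) n s)" if Ps: "P p s" for s n
    proof -
      obtain y where "P p ((from_nat n, y) # s)" using forward[OF p Ps] by blast
      then have "P p ((from_nat n, from_nat (to_nat y)) # s)" by simp
      then show ?thesis unfolding forth_step_def
        by (rule LeastI[where P = "\<lambda>m. P p ((from_nat n, from_nat m) # s)"])
    qed
    have bs: "P p (back_step (P p) n s)" if Ps: "P p s" for s n
    proof -
      obtain x where "P p ((x, from_nat n) # s)" using backward[OF p Ps] by blast
      then have "P p ((from_nat (to_nat x), from_nat n) # s)" by simp
      then show ?thesis unfolding back_step_def
        by (rule LeastI[where P = "\<lambda>m. P p ((from_nat m, from_nat n) # s)"])
    qed
    have PB: "P p (?B n)" for n
      by (induction n) (use Nil[OF p] fs bs in auto)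
    have "set (?B n) \<subseteq> set (?B (Suc n))" for n
      by (auto simp: back_step_def forth_step_def)
    then have mono: "m \<le> n \<Longrightarrow> set (?B m) \<subseteq> set (?B n)" for m n
      by (rule lift_Suc_mono_le)
    have fB: "(x, f p x) \<in> set (?B (Suc (to_nat x)))" for x
      unfolding f_def
      by (rule someI_ex) (auto simp: back_step_def forth_step_def)
    have pair: "\<exists>s. P p s \<and> (x, f p x) \<in> set s \<and> (y, f p y) \<in> set s" for x y
    proof (intro exI conjI)
      let ?n = "max (Suc (to_nat x)) (Suc (to_nat y))"
      show "P p (?B ?n)" by (rule PB)
      show "(x, f p x) \<in> set (?B ?n)" using fB[of x] mono[of "Suc (to_nat x)" ?n] by auto
      show "(y, f p y) \<in> set (?B ?n)" using fB[of y] mono[of "Suc (to_nat y)" ?n] by auto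
    qed
    have "inj (f p)"
      using pair inj[OF p] by (intro injI) metis
    moreover have "surj (f p)"
    unfolding surj_def
    proof
      fix y
      have "\<exists>x. (x, y) \<in> set (?B (Suc (to_nat y)))"
        by (auto simp: back_step_def)
      then obtain x where x: "(x, y) \<in> set (?B (Suc (to_nat y)))" by blast
      let ?n = "max (Suc (to_nat x)) (Suc (to_nat y))"
      have "(x, f p x) \<in> set (?B ?n)" "(x, y) \<in> set (?B ?n)"
        using fB[of x] x mono[of "Suc (to_nat x)" ?n] mono[of "Suc (to_nat y)" ?n] by auto
      then have "y = f p x" using inj[OF p PB] by blast
      then show "\<exists>x. y = f p x" by blast
    qed
    ultimately show ?thesis using pair by (simp add: bij_def)
  qed
  ultimately show ?thesis by blast
qed

section \<open>The extension property of the semigeneric digraph\<close>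

lemma perp_sym: "perp H x y \<longleftrightarrow> perp H y x"
  by (auto simp: perp_def)

text \<open>Parity in terms of rows: two rows of the edge matrix between two parts are equal or
  opposite, that is, the matrix of signs has rank one.\<close>

definition rank_one :: "('a \<Rightarrow> 'a \<Rightarrow> bool) \<Rightarrow> bool" where
  "rank_one H \<longleftrightarrow> (\<forall>a a' b b'. perp H a a' \<and> perp H b b' \<and> \<not> perp H a b \<longrightarrow>
     ((H a b \<longleftrightarrow> H a' b) \<longleftrightarrow> (H a b' \<longleftrightarrow> H a' b')))"

text \<open>\<open>Q\<close> prescribes the out-neighbours in \<open>D\<close> of a vertex whose
  part does not meet \<open>D\<close>.\<close>

definition ext_new :: "('a \<Rightarrow> 'a \<Rightarrow> bool) \<Rightarrow> bool" where
  "ext_new H \<longleftrightarrow> (\<forall>D Q. finite D \<longrightarrow>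
     (\<exists>y. y \<notin> D \<and> (\<forall>a\<in>D. (H y a \<longleftrightarrow> Q a) \<and> (H a y \<longleftrightarrow> \<not> Q a))))"

text \<open>Here the new vertex lies in the part of \<open>r\<close>. The condition on
  \<open>Q\<close> is what \<open>rank_one\<close> forces: on each other part, the prescribed row is
  equal or opposite to the row of \<open>r\<close>.\<close>

definition ext_old :: "('a \<Rightarrow> 'a \<Rightarrow> bool) \<Rightarrow> bool" where
  "ext_old H \<longleftrightarrow> (\<forall>D Q r. finite D \<and> r \<in> D \<and>
     (\<forall>a\<in>D. \<forall>b\<in>D. \<not> perp H r a \<and> perp H a b \<longrightarrow> ((Q a \<longleftrightarrow> Q b) \<longleftrightarrow> (H r a \<longleftrightarrow> H r b))) \<longrightarrow>
     (\<exists>y. y \<notin> D \<and> perp H y r \<and> (\<forall>a\<in>D. \<not> perp H r a \<longrightarrow> (H y a \<longleftrightarrow> Q a))))"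

definition semigeneric :: "('a \<Rightarrow> 'a \<Rightarrow> bool) \<Rightarrow> bool" where
  "semigeneric H \<longleftrightarrow> complete_multipartite UNIV H \<and> rank_one H \<and> ext_new H \<and> ext_old H"

lemma semigenericD:
  assumes "semigeneric H"
  shows "\<not> H x x" "H x y \<Longrightarrow> \<not> H y x" "perp H x y \<Longrightarrow> perp H y z \<Longrightarrow> perp H x z"
  using assms unfolding semigeneric_def complete_multipartite_def digraph_def by blast+

lemma semigeneric_ext_new:
  assumes "semigeneric H" "finite D"
  shows "\<exists>y. y \<notin> D \<and> (\<forall>a\<in>D. (H y a \<longleftrightarrow> Q a) \<and> (H a y \<longleftrightarrow> \<not> Q a))"
proof -
  have "ext_new H" using assms(1) by (simp add: semigeneric_def)
  from this[unfolded ext_new_def, rule_format, OF assms(2)] show ?thesis .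
qed

lemma semigeneric_ext_old:
  assumes "semigeneric H" "finite D" "r \<in> D"
    and "\<And>a b. a \<in> D \<Longrightarrow> b \<in> D \<Longrightarrow> \<not> perp H r a \<Longrightarrow> perp H a b \<Longrightarrow>
      (Q a \<longleftrightarrow> Q b) \<longleftrightarrow> (H r a \<longleftrightarrow> H r b)"
  shows "\<exists>y. y \<notin> D \<and> perp H y r \<and> (\<forall>a\<in>D. \<not> perp H r a \<longrightarrow> (H y a \<longleftrightarrow> Q a))"
proof -
  have "ext_old H" using assms(1) by (simp add: semigeneric_def)
  moreover have "finite D \<and> r \<in> D \<and>
     (\<forall>a\<in>D. \<forall>b\<in>D. \<not> perp H r a \<and> perp H a b \<longrightarrow> ((Q a \<longleftrightarrow> Q b) \<longleftrightarrow> (H r a \<longleftrightarrow> H r b)))"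
    using assms(2-4) by blast
  ultimately show ?thesis unfolding ext_old_def by (elim allE impE)
qed

lemma even_edges_iff:
  assumes "a \<noteq> a'" "b \<noteq> b'"
  shows "even (card {(x, y). x \<in> {a, a'} \<and> y \<in> {b, b'} \<and> E x y}) \<longleftrightarrow>
    ((E a b \<longleftrightarrow> E a' b) \<longleftrightarrow> (E a b' \<longleftrightarrow> E a' b'))"
proof -
  have "{(x, y). x \<in> {a, a'} \<and> y \<in> {b, b'} \<and> E x y} =
      (if E a b then {(a, b)} else {}) \<union> (if E a' b then {(a', b)} else {}) \<union>
      (if E a b' then {(a, b')} else {}) \<union> (if E a' b' then {(a', b')} else {})"
    by auto
  then show ?thesis using assms by (simp add: card_insert_if)
qed

text \<open>Evenness of the count turns into an equation between four bits, which is a tautology for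
  \<open>a = a'\<close> or \<open>b = b'\<close>.\<close>

lemma parity_property_iff:
  "parity_property V E \<longleftrightarrow> (\<forall>a\<in>V. \<forall>a'\<in>V. \<forall>b\<in>V. \<forall>b'\<in>V.
     perp E a a' \<and> perp E b b' \<and> \<not> perp E a b \<longrightarrow>
       ((E a b \<longleftrightarrow> E a' b) \<longleftrightarrow> (E a b' \<longleftrightarrow> E a' b')))"
proof -
  have "(a \<noteq> a' \<and> b \<noteq> b' \<and> perp E a a' \<and> perp E b b' \<and> \<not> perp E a b \<longrightarrow>
        even (card {(x, y). x \<in> {a, a'} \<and> y \<in> {b, b'} \<and> E x y})) \<longleftrightarrow>
      (perp E a a' \<and> perp E b b' \<and> \<not> perp E a b \<longrightarrow>
        ((E a b \<longleftrightarrow> E a' b) \<longleftrightarrow> (E a b' \<longleftrightarrow> E a' b')))" for a a' b b'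
    using even_edges_iff[of a a' b b' E] by blast
  then show ?thesis unfolding parity_property_def by simp
qed

section \<open>Extending finite partial isomorphisms by one point\<close>

definition piso :: "('a \<Rightarrow> 'a \<Rightarrow> bool) \<Rightarrow> ('b \<Rightarrow> 'b \<Rightarrow> bool) \<Rightarrow> ('a \<times> 'b) list \<Rightarrow> bool" where
  "piso H K s \<longleftrightarrow> (\<forall>(x, y) \<in> set s. \<forall>(x', y') \<in> set s. (x = x' \<longleftrightarrow> y = y') \<and> (H x x' \<longleftrightarrow> K y y'))"

lemma pisoD:
  assumes "piso H K s" "(x, y) \<in> set s" "(x', y') \<in> set s"
  shows "x = x' \<longleftrightarrow> y = y'" "H x x' \<longleftrightarrow> K y y'" "perp H x x' \<longleftrightarrow> perp K y y'"
  using assms unfolding piso_def perp_def by fast+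

lemma piso_swap: "piso K H (map prod.swap s) \<longleftrightarrow> piso H K s"
  unfolding piso_def by auto

lemma piso_Cons:
  assumes "piso H K s" "\<not> H x x" "\<not> K y y"
    and "\<And>x' y'. (x', y') \<in> set s \<Longrightarrow> x \<noteq> x' \<and> y \<noteq> y' \<and> (H x x' \<longleftrightarrow> K y y') \<and> (H x' x \<longleftrightarrow> K y' y)"
  shows "piso H K ((x, y) # s)"
  using assms unfolding piso_def by fastforce

text \<open>A point outside the domain either shares a part with some \<open>r\<close> in the
  domain, and its image comes from \<open>ext_old\<close>, or opens a new part, and its image comes
  from \<open>ext_new\<close>.\<close>

lemma semigeneric_forth:
  assumes H: "semigeneric H" and K: "semigeneric K" and s: "piso H K s"
  shows "\<exists>y. piso H K ((x, y) # s)"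
proof (cases "x \<in> fst ` set s")
  case True
  then obtain y where "(x, y) \<in> set s" by auto
  then have eq: "set ((x, y) # s) = set s" by auto
  have "piso H K ((x, y) # s)" using s unfolding piso_def eq .
  then show ?thesis ..
next
  case False
  note Hd = semigenericD(1,2)[OF H] and Kd = semigenericD(1,2)[OF K]
    and Ht = semigenericD(3)[OF H] and Kt = semigenericD(3)[OF K]
  have Hr: "rank_one H" using H by (simp add: semigeneric_def)
  define D where "D = snd ` set s"
  \<comment> \<open>\<open>Q\<close> transports the out-neighbours of \<open>x\<close> along
    \<open>s\<close>.\<close>
  define Q where "Q y \<longleftrightarrow> (\<exists>x'. (x', y) \<in> set s \<and> H x x')" for y
  have Q: "Q b \<longleftrightarrow> H x a" if "(a, b) \<in> set s" for a b
    using that pisoD(1)[OF s] unfolding Q_def by blast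
  have fin: "finite D" by (simp add: D_def)
  show ?thesis
  proof (cases "\<exists>r r'. (r, r') \<in> set s \<and> perp H x r")
    case True
    then obtain r r' where r: "(r, r') \<in> set s" "perp H x r" by blast
    \<comment> \<open>\<open>rank_one H\<close>, applied to the pair \<open>x\<close>,
      \<open>r\<close> against \<open>a\<close>, \<open>b\<close>, gives the compatibility on the
      side of \<open>H\<close>; \<open>s\<close> carries it over to \<open>K\<close>.\<close>
    have compat: "(Q a' \<longleftrightarrow> Q b') \<longleftrightarrow> (K r' a' \<longleftrightarrow> K r' b')"
      if in_D: "a' \<in> D" "b' \<in> D" and "\<not> perp K r' a'" "perp K a' b'" for a' b'
    proof -
      obtain a b where ab: "(a, a') \<in> set s" "(b, b') \<in> set s" using in_D unfolding D_def by auto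
      have "\<not> perp H r a" "perp H a b"
        using pisoD(3)[OF s r(1) ab(1)] pisoD(3)[OF s ab] that by auto
      moreover from this have "\<not> perp H x a" using Ht perp_sym r(2) by metis
      ultimately have "(H x a \<longleftrightarrow> H r a) \<longleftrightarrow> (H x b \<longleftrightarrow> H r b)"
        using Hr r(2) unfolding rank_one_def by blast
      then show ?thesis
        using Q[OF ab(1)] Q[OF ab(2)] pisoD(2)[OF s r(1) ab(1)] pisoD(2)[OF s r(1) ab(2)] by blast
    qed
    have "r' \<in> D" using r by (force simp: D_def)
    from semigeneric_ext_old[OF K fin this, where Q = Q, OF compat] obtain y where y: "y \<notin> D" "perp K y r'"
      "\<And>a. a \<in> D \<Longrightarrow> \<not> perp K r' a \<Longrightarrow> K y a \<longleftrightarrow> Q a"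
      by blast
    have "piso H K ((x, y) # s)"
    proof (rule piso_Cons[OF s Hd(1) Kd(1)])
      fix x' y' assume xy: "(x', y') \<in> set s"
      then have yD: "y' \<in> D" by (force simp: D_def)
      have "(H x x' \<longleftrightarrow> K y y') \<and> (H x' x \<longleftrightarrow> K y' y)"
      proof (cases "perp K r' y'")
        case True
        then have "perp H x x'" "perp K y y'"
          using Ht[OF r(2)] Kt[OF y(2)] pisoD(3)[OF s r(1) xy] by auto
        then show ?thesis by (auto simp: perp_def)
      next
        case False
        then have "\<not> perp H x x'" "\<not> perp K y y'"
          using Ht Kt r(2) y(2) perp_sym pisoD(3)[OF s r(1) xy] by metis+
        moreover have "H x x' \<longleftrightarrow> K y y'" using y(3)[OF yD False] Q[OF xy] by simp
        ultimately show ?thesis using Hd(2) Kd(2) unfolding perp_def by blast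
      qed
      then show "x \<noteq> x' \<and> y \<noteq> y' \<and> (H x x' \<longleftrightarrow> K y y') \<and> (H x' x \<longleftrightarrow> K y' y)"
        using False xy yD y(1) by force
    qed
    then show ?thesis by blast
  next
    case new: False
    obtain y where y: "y \<notin> D" "\<And>a. a \<in> D \<Longrightarrow> (K y a \<longleftrightarrow> Q a) \<and> (K a y \<longleftrightarrow> \<not> Q a)"
      using semigeneric_ext_new[OF K fin, where Q = Q] by blast
    have "piso H K ((x, y) # s)"
    proof (rule piso_Cons[OF s Hd(1) Kd(1)])
      fix x' y' assume xy: "(x', y') \<in> set s"
      then have yD: "y' \<in> D" by (force simp: D_def)
      have "\<not> perp H x x'" using new xy by blast
      then have "H x' x \<longleftrightarrow> \<not> H x x'" using Hd(2) unfolding perp_def by blast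
      then show "x \<noteq> x' \<and> y \<noteq> y' \<and> (H x x' \<longleftrightarrow> K y y') \<and> (H x' x \<longleftrightarrow> K y' y)"
        using False xy yD y Q[OF xy] by force
    qed
    then show ?thesis by blast
  qed
qed

lemma semigeneric_back:
  assumes "semigeneric H" "semigeneric K" "piso H K s"
  shows "\<exists>x. piso H K ((x, y) # s)"
proof -
  have "piso K H (map prod.swap s)" using assms(3) by (simp add: piso_swap)
  then obtain x where "piso K H (map prod.swap ((x, y) # s))"
    using semigeneric_forth[OF assms(2,1)] by auto
  then show ?thesis unfolding piso_swap by blast
qed

section \<open>The extension property of the given limit\<close>

lemma semigeneric_limit_extend:
  assumes G: "semigeneric_limit G" and D: "finite D" and v: "v \<notin> D"
    and C: "class_C (insert v D) E"
    and ED: "\<And>x y. x \<in> D \<Longrightarrow> y \<in> D \<Longrightarrow> E x y \<longleftrightarrow> G x y"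
  shows "\<exists>y. y \<notin> D \<and> (\<forall>a\<in>D. (G y a \<longleftrightarrow> E v a) \<and> (G a y \<longleftrightarrow> E a v))"
proof -
  have age: "\<exists>f. inj_on f V \<and> (\<forall>x\<in>V. \<forall>y\<in>V. E x y \<longleftrightarrow> G (f x) (f y))"
    if "class_C V E" for V :: "nat set" and E
    using G that by (simp add: semigeneric_limit_def)
  have homogeneous: "\<exists>\<sigma>. automorphism G \<sigma> \<and> (\<forall>x\<in>A. \<sigma> x = p x)"
    if "finite A" "inj_on p A" "\<forall>x\<in>A. \<forall>y\<in>A. G x y \<longleftrightarrow> G (p x) (p y)" for A p
    using G that by (simp add: semigeneric_limit_def)
  \<comment> \<open>The age supplies a copy of the extended digraph somewhere in \<open>G\<close>;
    homogeneity then moves the copy of \<open>D\<close> back onto \<open>D\<close>, and the vertex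
    that \<open>v\<close> ends up at is the required one.\<close>
  obtain f where inj: "inj_on f (insert v D)"
    and f: "\<And>x y. x \<in> insert v D \<Longrightarrow> y \<in> insert v D \<Longrightarrow> E x y \<longleftrightarrow> G (f x) (f y)"
    using age[OF C] by blast
  define p where "p = the_inv_into D f"
  have inj_f: "inj_on f D" using inj by (rule inj_on_subset) auto
  have pf: "p (f x) = x" if "x \<in> D" for x
    unfolding p_def using the_inv_into_f_f[OF inj_f that] .
  have "finite (f ` D)" "inj_on p (f ` D)"
    using D pf by (auto intro: inj_onI)
  moreover have "\<forall>x\<in>f ` D. \<forall>y\<in>f ` D. G x y \<longleftrightarrow> G (p x) (p y)"
    using pf f ED by auto
  ultimately obtain \<sigma> where \<sigma>: "automorphism G \<sigma>" "\<forall>x\<in>f ` D. \<sigma> x = p x"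
    using homogeneous[of "f ` D" p] by blast
  have \<sigma>f: "\<sigma> (f x) = x" if "x \<in> D" for x using \<sigma>(2) pf that by auto
  have "inj \<sigma>" using \<sigma>(1) by (simp add: automorphism_def bij_is_inj)
  show ?thesis
  proof (intro exI conjI ballI)
    show "\<sigma> (f v) \<notin> D"
    proof
      assume *: "\<sigma> (f v) \<in> D"
      have "f (\<sigma> (f v)) = f v" using injD[OF \<open>inj \<sigma>\<close> \<sigma>f[OF *]] .
      then have "\<sigma> (f v) = v" using inj_onD[OF inj] * by blast
      then show False using * v by simp
    qed
    fix a assume a: "a \<in> D"
    have "G x y \<longleftrightarrow> G (\<sigma> x) (\<sigma> y)" for x y using \<sigma>(1) by (simp add: automorphism_def)
    then show "G (\<sigma> (f v)) a \<longleftrightarrow> E v a" "G a (\<sigma> (f v)) \<longleftrightarrow> E a v"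
      using \<sigma>f[OF a] f a by (metis insertCI)+
  qed
qed

lemma semigeneric_limit_imp_semigeneric:
  assumes G: "semigeneric_limit G"
  shows "semigeneric G"
proof -
  have C: "class_C V G" if "finite V" for V
    using G that by (simp add: semigeneric_limit_def)
  have irr: "\<not> G x x" and asym: "G x y \<Longrightarrow> \<not> G y x" for x y
    using G by (auto simp: semigeneric_limit_def digraph_def)
  have trans: "perp G x z" if "perp G x y" "perp G y z" for x y z
    using C[of "{x, y, z}"] that unfolding class_C_def complete_multipartite_def by blast
  have par: "(G a b \<longleftrightarrow> G a' b) \<longleftrightarrow> (G a b' \<longleftrightarrow> G a' b')"
    if "perp G a a'" "perp G b b'" "\<not> perp G a b" for a a' b b'
    using C[of "{a, a', b, b'}"] that unfolding class_C_def parity_property_iff by blast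
  have "ext_new G"
    unfolding ext_new_def
  proof (intro allI impI)
    fix D :: "nat set" and Q
    assume D: "finite D"
    obtain v where v: "v \<notin> D" using ex_new_if_finite[OF infinite_UNIV_nat D] by blast
    \<comment> \<open>\<open>v\<close> forms a part of its own, so it cannot occur in a parity
      condition on two pairs of distinct vertices.\<close>
    define E where "E x y \<longleftrightarrow> (if x = v then y \<noteq> v \<and> Q y else if y = v then \<not> Q x else G x y)" for x y
    have pE: "perp E x y \<longleftrightarrow> (if x = v \<or> y = v then x = y else perp G x y)" for x y
      using irr by (auto simp: perp_def E_def)
    have "complete_multipartite (insert v D) E"
      unfolding complete_multipartite_def digraph_def
    proof (intro conjI ballI impI)
      show "\<not> E x x" for x using irr by (simp add: E_def)
      show "\<not> E y x" if "E x y" for x y using that asym by (auto simp: E_def split: if_splits)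
      show "perp E x z" if "perp E x y \<and> perp E y z" for x y z
        using that trans unfolding pE by (auto split: if_splits)
    qed
    moreover have "parity_property (insert v D) E"
      unfolding parity_property_iff
    proof (intro ballI impI)
      fix a a' b b'
      assume *: "perp E a a' \<and> perp E b b' \<and> \<not> perp E a b"
      show "(E a b \<longleftrightarrow> E a' b) \<longleftrightarrow> (E a b' \<longleftrightarrow> E a' b')"
      proof (cases "a = a' \<or> b = b'")
        case False
        then have "v \<notin> {a, a', b, b'}" using * unfolding pE by (auto split: if_splits)
        then show ?thesis using * par[of a a' b b'] unfolding pE by (simp add: E_def)
      qed auto
    qed
    ultimately have "class_C (insert v D) E" using D by (simp add: class_C_def)
    moreover have "E x y \<longleftrightarrow> G x y" if "x \<in> D" "y \<in> D" for x y
      using that v by (auto simp: E_def)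
    ultimately have "\<exists>y. y \<notin> D \<and> (\<forall>a\<in>D. (G y a \<longleftrightarrow> E v a) \<and> (G a y \<longleftrightarrow> E a v))"
      using semigeneric_limit_extend[OF G D v] by simp
    moreover have "E v a \<longleftrightarrow> Q a" "E a v \<longleftrightarrow> \<not> Q a" if "a \<in> D" for a
      using that v by (auto simp: E_def)
    ultimately show "\<exists>y. y \<notin> D \<and> (\<forall>a\<in>D. (G y a \<longleftrightarrow> Q a) \<and> (G a y \<longleftrightarrow> \<not> Q a))"
      by auto
  qed
  moreover have "ext_old G"
    unfolding ext_old_def
  proof (intro allI impI, elim conjE)
    fix D :: "nat set" and Q r
    assume D: "finite D" and r: "r \<in> D" and Q: "\<forall>a\<in>D. \<forall>b\<in>D. \<not> perp G r a \<and> perp G a b \<longrightarrow>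
      ((Q a \<longleftrightarrow> Q b) \<longleftrightarrow> (G r a \<longleftrightarrow> G r b))"
    obtain v where v: "v \<notin> D" using ex_new_if_finite[OF infinite_UNIV_nat D] by blast
    \<comment> \<open>Now \<open>v\<close> joins the part of \<open>r\<close> and follows
      \<open>Q\<close> outside that part.\<close>
    define E where "E x y \<longleftrightarrow> (if x = v then y \<noteq> v \<and> \<not> perp G r y \<and> Q y
      else if y = v then \<not> perp G r x \<and> \<not> Q x else G x y)" for x y
    \<comment> \<open>Collapsing \<open>v\<close> to \<open>r\<close> makes non-adjacency in
      \<open>E\<close> the pullback of non-adjacency in \<open>G\<close>.\<close>
    define u where "u x = (if x = v then r else x)" for x
    have prr: "perp G x x" for x using irr by (simp add: perp_def)
    have pE: "perp E x y \<longleftrightarrow> perp G (u x) (u y)" for x y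
      using irr prr perp_sym[of G r] by (auto simp: perp_def E_def u_def)
    have "complete_multipartite (insert v D) E"
      unfolding complete_multipartite_def digraph_def
    proof (intro conjI ballI impI)
      show "\<not> E x x" for x using irr by (simp add: E_def)
      show "\<not> E y x" if "E x y" for x y using that asym by (auto simp: E_def split: if_splits)
      show "perp E x z" if "perp E x y \<and> perp E y z" for x y z
        using that trans unfolding pE by blast
    qed
    moreover have "parity_property (insert v D) E"
      unfolding parity_property_iff
    proof (intro ballI impI)
      have flip: "E y x \<longleftrightarrow> \<not> E x y" if "\<not> perp E x y" for x y
        using that asym unfolding perp_def E_def by (auto split: if_splits)
      \<comment> \<open>By the assumption on \<open>Q\<close>, the row of \<open>v\<close> on
        another part is equal or opposite to the row of \<open>r\<close>. This reduces
        \<open>main\<close> to parity in \<open>G\<close>.\<close>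
      have left: "(E a b \<longleftrightarrow> G (u a) b) \<longleftrightarrow> (E a b' \<longleftrightarrow> G (u a) b')"
        if "b \<in> D" "b' \<in> D" "perp G b b'" "\<not> perp G (u a) b" for a b b'
      proof (cases "a = v")
        case True
        then have ra: "\<not> perp G r b" using that by (simp add: u_def)
        then have rb: "\<not> perp G r b'" using that(3) trans perp_sym by metis
        have "(Q b \<longleftrightarrow> Q b') \<longleftrightarrow> (G r b \<longleftrightarrow> G r b')" using Q that ra by blast
        moreover have "E v b \<longleftrightarrow> Q b" "E v b' \<longleftrightarrow> Q b'"
          using ra rb that v by (auto simp: E_def)
        ultimately show ?thesis using True by (simp add: u_def) blast
      next
        case False
        then show ?thesis using that v by (auto simp: E_def u_def)
      qed
      have main: "(E a b \<longleftrightarrow> E a' b) \<longleftrightarrow> (E a b' \<longleftrightarrow> E a' b')"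
        if "b \<in> D" "b' \<in> D" "perp E a a'" "perp E b b'" "\<not> perp E a b" for a a' b b'
      proof -
        have b: "u b = b" "u b' = b'" using that v by (auto simp: u_def)
        then have p: "perp G (u a) (u a')" "perp G b b'" "\<not> perp G (u a) b"
          using that unfolding pE by auto
        then have "\<not> perp G (u a') b" using trans by blast
        then show ?thesis
          using left[OF that(1,2) p(2,3)] left[OF that(1,2) p(2), of a'] par[OF p] by blast
      qed
      fix a a' b b'
      assume in_D: "a \<in> insert v D" "a' \<in> insert v D" "b \<in> insert v D" "b' \<in> insert v D"
      assume *: "perp E a a' \<and> perp E b b' \<and> \<not> perp E a b"
      show "(E a b \<longleftrightarrow> E a' b) \<longleftrightarrow> (E a b' \<longleftrightarrow> E a' b')"
      proof (cases "v = b \<or> v = b'")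
        case False
        then show ?thesis using main in_D * by auto
      next
        case True
        have np: "\<not> perp E x y" if "x \<in> {a, a'}" "y \<in> {b, b'}" for x y
          using that * trans perp_sym unfolding pE by (metis insertE singletonD)
        then have "a \<noteq> v" "a' \<noteq> v" using True * perp_sym[of E] by auto
        \<comment> \<open>With \<open>v\<close> among \<open>b\<close>, \<open>b'\<close>, the
          vertices \<open>a\<close>, \<open>a'\<close> lie in \<open>D\<close>, so
          \<open>main\<close> applies with the two pairs exchanged; \<open>flip\<close> then
          transposes the result.\<close>
        then have "(E b a \<longleftrightarrow> E b' a) \<longleftrightarrow> (E b a' \<longleftrightarrow> E b' a')"
          using main[of a a' b b'] in_D * np perp_sym[of E] by auto
        then show ?thesis using flip[OF np] by auto
      qed
    qed
    ultimately have "class_C (insert v D) E" using D by (simp add: class_C_def)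
    moreover have "E x y \<longleftrightarrow> G x y" if "x \<in> D" "y \<in> D" for x y
      using that v by (auto simp: E_def)
    ultimately have "\<exists>y. y \<notin> D \<and> (\<forall>a\<in>D. (G y a \<longleftrightarrow> E v a) \<and> (G a y \<longleftrightarrow> E a v))"
      using semigeneric_limit_extend[OF G D v] by simp
    then obtain y where y: "y \<notin> D" "\<And>a. a \<in> D \<Longrightarrow> (G y a \<longleftrightarrow> E v a) \<and> (G a y \<longleftrightarrow> E a v)"
      by blast
    have "perp G y r" using y(2)[OF r] prr r v by (auto simp: E_def perp_def)
    moreover have "G y a \<longleftrightarrow> Q a" if "a \<in> D" "\<not> perp G r a" for a
      using y(2)[of a] that v by (auto simp: E_def)
    ultimately show "\<exists>y. y \<notin> D \<and> perp G y r \<and> (\<forall>a\<in>D. \<not> perp G r a \<longrightarrow> (G y a \<longleftrightarrow> Q a))"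
      using y(1) by blast
  qed
  moreover have "complete_multipartite UNIV G"
    using irr asym trans unfolding complete_multipartite_def digraph_def by blast
  moreover have "rank_one G"
    using par unfolding rank_one_def by blast
  ultimately show ?thesis by (simp add: semigeneric_def)
qed

section \<open>The free semigeneric digraph over a tournament\<close>

text \<open>The function \<open>cls\<close> below picks a representative of the part of a vertex.  The part of
  \<open>Root n S\<close> is generic over the vertices listed in \<open>S\<close>, and \<open>El n c P\<close> is a
  vertex in the part of \<open>c\<close> that is generic over the parts listed in \<open>P\<close>.\<close>

datatype 'b vx = Base 'b | Root int "'b vx list" | El int "'b vx" "'b vx list"

instance vx :: (countable) countable by countable_datatype

primrec cls :: "'b vx \<Rightarrow> 'b vx" where
  "cls (Base b) = Base b"
| "cls (Root n S) = Root n S"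
| "cls (El n c P) = cls c"

primrec members :: "'b vx \<Rightarrow> 'b vx list" where
  "members (Base b) = []"
| "members (Root n S) = S"
| "members (El n c P) = []"

primrec flips :: "'b vx \<Rightarrow> 'b vx list" where
  "flips (Base b) = []"
| "flips (Root n S) = []"
| "flips (El n c P) = P"

primrec tag :: "'b vx \<Rightarrow> int" where
  "tag (Base b) = 0"
| "tag (Root n S) = n"
| "tag (El n c P) = n"

text \<open>Nothing but \<open>T\<close>, equality and the order of tags enters the recursion, so
  the result is preserved by tag shifts and by isomorphisms of \<open>T\<close>. It is defined on
  all vertices, not only on representatives of parts, because the lists inside roots contain
  arbitrary vertices.\<close>

fun vless :: "('b \<Rightarrow> 'b \<Rightarrow> bool) \<Rightarrow> 'b vx \<Rightarrow> 'b vx \<Rightarrow> bool"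
  and vlless :: "('b \<Rightarrow> 'b \<Rightarrow> bool) \<Rightarrow> 'b vx list \<Rightarrow> 'b vx list \<Rightarrow> bool" where
  "vless T (Base b) (Base b') = T b b'"
| "vless T (Base b) (Root m S') = True"
| "vless T (Base b) (El m d Q) = True"
| "vless T (Root n S) (Base b') = False"
| "vless T (Root n S) (Root m S') = (if n = m then vlless T S S' else n < m)"
| "vless T (Root n S) (El m d Q) = True"
| "vless T (El n c P) (Base b') = False"
| "vless T (El n c P) (Root m S') = False"
| "vless T (El n c P) (El m d Q) =
     (if n = m then if c = d then vlless T P Q else vless T c d else n < m)"
| "vlless T [] [] = False"
| "vlless T [] (y # ys) = True"
| "vlless T (x # xs) [] = False"
| "vlless T (x # xs) (y # ys) = (if x = y then vlless T xs ys else vless T x y)"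

definition tournament :: "('b \<Rightarrow> 'b \<Rightarrow> bool) \<Rightarrow> bool" where
  "tournament T \<longleftrightarrow> (\<forall>x. \<not> T x x) \<and> (\<forall>x y. x \<noteq> y \<longrightarrow> (T y x \<longleftrightarrow> \<not> T x y))"

lemma vless_flip:
  assumes "tournament T"
  shows "x \<noteq> y \<Longrightarrow> vless T y x \<longleftrightarrow> \<not> vless T x y"
    and "xs \<noteq> ys \<Longrightarrow> vlless T ys xs \<longleftrightarrow> \<not> vlless T xs ys"
  using assms
proof (induction T x y and T xs ys rule: vless_vlless.induct)
  case (1 T b b')
  then have "b \<noteq> b'" by simp
  then show ?case using \<open>tournament T\<close> unfolding tournament_def vless.simps by blast
qed auto

lemma measurable_vless:
  fixes T :: "'p \<Rightarrow> 'b \<Rightarrow> 'b \<Rightarrow> bool"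
  assumes T: "\<And>b b'. (\<lambda>p. T p b b') \<in> measurable M (count_space UNIV)"
  shows "(\<lambda>p. vless (T p) x y) \<in> measurable M (count_space UNIV)"
    and "(\<lambda>p. vlless (T p) xs ys) \<in> measurable M (count_space UNIV)"
  using T
  \<comment> \<open>The rule lends only its recursion pattern, so its tournament argument may be
    \<open>undefined\<close>: each value is a constant or a value of \<open>T p\<close>.\<close>
  by (induction "undefined :: 'b \<Rightarrow> 'b \<Rightarrow> bool" x y and "undefined :: 'b \<Rightarrow> 'b \<Rightarrow> bool" xs ys
      rule: vless_vlless.induct) simp_all

text \<open>The bit of the vertex \<open>a\<close> at the part represented by \<open>i\<close>. It
  can be set from either side, by a part listing vertices or by a vertex listing parts, so finitely
  many bits can be prescribed both for a new part and for a new vertex.\<close>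

definition adj :: "'b vx \<Rightarrow> 'b vx \<Rightarrow> bool" where
  "adj a i \<longleftrightarrow> (a \<in> set (members i)) \<noteq> (i \<in> set (flips a))"

definition edge :: "('b \<Rightarrow> 'b \<Rightarrow> bool) \<Rightarrow> 'b vx \<Rightarrow> 'b vx \<Rightarrow> bool" where
  "edge T a b \<longleftrightarrow> cls a \<noteq> cls b \<and> ((vless T (cls a) (cls b) \<noteq> adj a (cls b)) \<noteq> adj b (cls a))"

lemma cls_cls [simp]: "cls (cls x) = cls x"
  by (induction x) auto

lemma edge_flip:
  assumes "tournament T" "cls a \<noteq> cls b"
  shows "edge T b a \<longleftrightarrow> \<not> edge T a b"
  using vless_flip(1)[OF assms] assms(2) unfolding edge_def by auto

lemma perp_edge:
  assumes "tournament T"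
  shows "perp (edge T) a b \<longleftrightarrow> cls a = cls b"
  using edge_flip[OF assms, of a b] unfolding perp_def by (auto simp: edge_def)

text \<open>Tags are compared before lists, so the parts contribute a known orientation to the edges
  of a root with a fresh tag, whatever it lists.\<close>

lemma vless_Root_tag:
  assumes "tag (cls a) < n"
  shows "\<not> vless T (Root n S) (cls a)"
proof -
  have "(\<exists>b. cls a = Base b) \<or> (\<exists>m S. cls a = Root m S)" by (induction a) auto
  then show ?thesis using assms by auto
qed

lemma fresh_tag:
  fixes X :: "'b vx set"
  assumes "finite X"
  obtains n where "\<And>x. x \<in> X \<Longrightarrow> tag x < n"
proof -
  have "tag x < Max (insert 0 (tag ` X)) + 1" if "x \<in> X" for x
    using assms that by (intro zle_add1_eq_le[THEN iffD2] Max_ge) auto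
  then show ?thesis using that by blast
qed

lemma semigeneric_edge:
  assumes T: "tournament T"
  shows "semigeneric (edge T)"
proof -
  \<comment> \<open>These are the vertices with which a new vertex must not coincide if its bits are
    to be free; a tag above all of theirs guarantees this.\<close>
  define nbd where "nbd D = D \<union> cls ` D \<union> (\<Union>a\<in>D. set (flips a)) \<union> (\<Union>a\<in>D. set (members (cls a)))"
    for D :: "'a vx set"
  have fresh: "\<exists>n. \<forall>x\<in>nbd D. tag x < n" if "finite D" for D
  proof -
    have "finite (nbd D)" using that by (simp add: nbd_def)
    then show ?thesis by (rule fresh_tag) blast
  qed
  have "complete_multipartite UNIV (edge T)"
    unfolding complete_multipartite_def digraph_def perp_edge[OF T]
    using edge_flip[OF T] by (auto simp: edge_def)
  moreover have "rank_one (edge T)"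
    unfolding rank_one_def perp_edge[OF T] by (auto simp: edge_def)
  moreover have "ext_new (edge T)"
    unfolding ext_new_def
  proof (intro allI impI)
    fix D :: "'a vx set" and Q
    assume D: "finite D"
    obtain n where n: "\<And>x. x \<in> nbd D \<Longrightarrow> tag x < n" using fresh[OF D] by blast
    obtain S where S: "set S = {a \<in> D. Q a}" using D finite_list[of "{a \<in> D. Q a}"] by auto
    \<comment> \<open>Freshness makes the orientation of the parts and the bit of \<open>y\<close>
      at \<open>cls a\<close> false, so the edge from \<open>y\<close> to \<open>a\<close> is
      decided by membership in \<open>S\<close> alone.\<close>
    define y where "y = Root n S"
    have ynbd: "y \<notin> nbd D" using n[of y] by (auto simp: y_def)
    have "edge T y a \<longleftrightarrow> Q a" and "cls y \<noteq> cls a" if a: "a \<in> D" for a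
    proof -
      have "cls a \<in> nbd D" using a by (auto simp: nbd_def)
      then have "tag (cls a) < n" by (rule n)
      moreover have "y \<notin> set (members (cls a))" "y \<notin> set (flips a)" "y \<noteq> cls a"
        using ynbd a by (auto simp: nbd_def)
      ultimately show "edge T y a \<longleftrightarrow> Q a" "cls y \<noteq> cls a"
        using vless_Root_tag[of a n T S] a S by (auto simp: edge_def adj_def y_def)
    qed
    moreover have "y \<notin> D" using ynbd by (auto simp: nbd_def)
    ultimately show "\<exists>y. y \<notin> D \<and> (\<forall>a\<in>D. (edge T y a \<longleftrightarrow> Q a) \<and> (edge T a y \<longleftrightarrow> \<not> Q a))"
      using edge_flip[OF T] by blast
  qed
  moreover have "ext_old (edge T)"
    unfolding ext_old_def perp_edge[OF T]
  proof (intro allI impI, elim conjE)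
    fix D :: "'a vx set" and Q r
    assume D: "finite D" and r: "r \<in> D" and Q: "\<forall>a\<in>D. \<forall>b\<in>D. cls r \<noteq> cls a \<and> cls a = cls b \<longrightarrow>
      ((Q a \<longleftrightarrow> Q b) \<longleftrightarrow> (edge T r a \<longleftrightarrow> edge T r b))"
    obtain n where n: "\<And>x. x \<in> nbd D \<Longrightarrow> tag x < n" using fresh[OF D] by blast
    \<comment> \<open>\<open>?F a\<close> says that the edge from \<open>y\<close> to
      \<open>a\<close> would come out wrong without a flip.\<close>
    let ?F = "\<lambda>a. (vless T (cls r) (cls a) \<noteq> adj a (cls r)) \<noteq> Q a"
    obtain P where P: "set P = cls ` {a \<in> D. ?F a}"
      using D finite_list[of "cls ` {a \<in> D. ?F a}"] by auto
    define y where "y = El n r P"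
    have ynbd: "y \<notin> nbd D" using n[of y] by (auto simp: y_def)
    have "edge T y a \<longleftrightarrow> Q a" if a: "a \<in> D" "cls r \<noteq> cls a" for a
    proof -
      \<comment> \<open>\<open>P\<close> lists parts, so the need for a flip must be the same for
        all vertices of \<open>D\<close> in one part; this is the compatibility of
        \<open>Q\<close>.\<close>
      have "cls a \<in> set P \<longleftrightarrow> ?F a"
      proof
        assume "cls a \<in> set P"
        then obtain b where b: "b \<in> D" "cls a = cls b" "?F b" using P by auto
        then have "(Q a \<longleftrightarrow> Q b) \<longleftrightarrow> (edge T r a \<longleftrightarrow> edge T r b)" using Q a by blast
        then show "?F a" using b a unfolding edge_def by auto
      qed (use P a in auto)
      moreover have "y \<notin> set (members (cls a))" using ynbd a by (auto simp: nbd_def)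
      ultimately show ?thesis using a by (auto simp: edge_def adj_def y_def)
    qed
    moreover have "y \<notin> D" using ynbd by (auto simp: nbd_def)
    moreover have "cls y = cls r" by (simp add: y_def)
    ultimately show "\<exists>y. y \<notin> D \<and> cls y = cls r \<and> (\<forall>a\<in>D. cls r \<noteq> cls a \<longrightarrow> (edge T y a \<longleftrightarrow> Q a))"
      by blast
  qed
  ultimately show ?thesis by (simp add: semigeneric_def)
qed

section \<open>Functoriality in the tournament and the tag shift\<close>

primrec act :: "int \<Rightarrow> ('b \<Rightarrow> 'c) \<Rightarrow> 'b vx \<Rightarrow> 'c vx" where
  "act k f (Base b) = Base (f b)"
| "act k f (Root n S) = Root (n + k) (map (act k f) S)"
| "act k f (El n c P) = El (n + k) (act k f c) (map (act k f) P)"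

lemma act_act: "act k f (act l g x) = act (k + l) (f \<circ> g) x"
  by (induction x) auto

lemma act_id: "act 0 id x = x"
  by (induction x) (auto intro: map_idI)

lemma bij_act:
  assumes "bij f"
  shows "bij (act k f)"
proof (rule o_bij)
  show "act (- k) (inv f) \<circ> act k f = id"
    using assms by (auto simp: act_act act_id bij_is_inj)
  show "act k f \<circ> act (- k) (inv f) = id"
    using assms by (auto simp: act_act act_id bij_is_surj surj_iff[THEN iffD1])
qed

text \<open>Tag comparisons are invariant under a common shift, and bijectivity of \<open>f\<close>
  keeps the equality tests of the recursion intact.\<close>

lemma vless_act:
  assumes f: "bij f" and T: "\<And>x y. T x y \<longleftrightarrow> T' (f x) (f y)"
  shows "vless T' (act k f x) (act k f y) \<longleftrightarrow> vless T x y"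
    and "vlless T' (map (act k f) xs) (map (act k f) ys) \<longleftrightarrow> vlless T xs ys"
  using T
  by (induction T x y and T xs ys rule: vless_vlless.induct)
    (auto simp: inj_eq[OF bij_is_inj[OF bij_act[OF f]]])

lemma edge_act:
  assumes f: "bij f" and T: "\<And>x y. T x y \<longleftrightarrow> T' (f x) (f y)"
  shows "edge T' (act k f x) (act k f y) \<longleftrightarrow> edge T x y"
proof -
  note inj = bij_is_inj[OF bij_act[OF f, of k]]
  have cls: "cls (act k f x) = act k f (cls x)" for x by (induction x) auto
  have members: "members (act k f x) = map (act k f) (members x)" for x by (cases x) auto
  have flips: "flips (act k f x) = map (act k f) (flips x)" for x by (cases x) auto
  have "adj (act k f a) (act k f i) \<longleftrightarrow> adj a i" for a i
    by (simp add: adj_def members flips inj_image_mem_iff[OF inj])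
  then show ?thesis
    by (simp add: edge_def cls inj_eq[OF inj] vless_act(1)[where T = T and T' = T', OF f T])
qed

lemma act_1_fixed: "act 1 id x = x \<longleftrightarrow> x \<in> range Base"
  by (cases x) auto

lemma edge_Base: "tournament T \<Longrightarrow> edge T (Base a) (Base b) \<longleftrightarrow> T a b"
  by (auto simp: edge_def adj_def tournament_def)

section \<open>Reducing isomorphism of tournaments to conjugacy\<close>

lemma measurable_Aut_space:
  assumes "\<And>p. p \<in> space M \<Longrightarrow> automorphism G (f p)"
    and "\<And>n. (\<lambda>p. f p n) \<in> measurable M (count_space UNIV)"
  shows "f \<in> measurable M (Aut_space G)"
  unfolding Aut_space_def
proof (rule measurable_restrict_space2)
  show "f \<in> space M \<rightarrow> {\<sigma>. automorphism G \<sigma>}" using assms(1) by auto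
  show "f \<in> measurable M (Pi\<^sub>M UNIV (\<lambda>_. count_space UNIV))"
    by (rule measurable_PiM_single') (use assms(2) in auto)
qed

lemma measurable_edge:
  assumes T: "\<And>b b'. (\<lambda>p. T p b b') \<in> measurable M (count_space UNIV)"
  shows "(\<lambda>p. edge (T p) a b) \<in> measurable M (count_space UNIV)"
  unfolding edge_def using measurable_vless(1)[OF T] by measurable

lemma measurable_piso_edge:
  assumes T: "\<And>b b'. (\<lambda>p. T p b b') \<in> measurable M (count_space UNIV)"
  shows "(\<lambda>p. piso (edge (T p)) G s) \<in> measurable M (count_space UNIV)"
proof -
  have "(\<lambda>p. piso (edge (T p)) G s) = (\<lambda>p. \<forall>u\<in>set s. \<forall>v\<in>set s.
      (fst u = fst v \<longleftrightarrow> snd u = snd v) \<and> (edge (T p) (fst u) (fst v) \<longleftrightarrow> G (snd u) (snd v)))"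
    unfolding piso_def by (auto simp: fun_eq_iff split_beta)
  also have "\<dots> \<in> measurable M (count_space UNIV)"
    using measurable_edge[OF T] by (intro pred_intros_finite finite_set pred_intros_logic) auto
  finally show ?thesis .
qed

text \<open>The tag shift, carried to \<open>G\<close> along a measurably chosen isomorphism, is the
  automorphism assigned to \<open>T p\<close>. Isomorphisms of tournaments act functorially and
  commute with the shift; conversely, a conjugating automorphism maps fixed points to fixed points,
  and these span the tournaments.\<close>

lemma tournament_iso_reducible:
  fixes T :: "'p \<Rightarrow> 'b::countable \<Rightarrow> 'b \<Rightarrow> bool"
  assumes G: "semigeneric_limit G"
    and meas: "\<And>b b'. (\<lambda>p. T p b b') \<in> measurable M (count_space UNIV)"
    and T: "\<And>p. p \<in> space M \<Longrightarrow> tournament (T p)"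
  shows "borel_reducible M (\<lambda>p q. \<exists>\<tau>. bij \<tau> \<and> (\<forall>x y. T p x y \<longleftrightarrow> T q (\<tau> x) (\<tau> y)))
    (Aut_space G) (conjugate G)"
proof -
  have sG: "semigeneric G" by (rule semigeneric_limit_imp_semigeneric[OF G])
  note sT = semigeneric_edge[OF T]
  have "\<exists>f. (\<forall>x. (\<lambda>p. f p x) \<in> measurable M (count_space UNIV)) \<and>
    (\<forall>p\<in>space M. bij (f p) \<and>
      (\<forall>x y. \<exists>s. piso (edge (T p)) G s \<and> (x, f p x) \<in> set s \<and> (y, f p y) \<in> set s))"
  proof (rule measurable_back_and_forth)
    show "(\<lambda>p. piso (edge (T p)) G s) \<in> measurable M (count_space UNIV)" for s
      by (rule measurable_piso_edge[OF meas])
    show "piso (edge (T p)) G []" for p by (simp add: piso_def)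
    show "\<exists>y. piso (edge (T p)) G ((x, y) # s)"
      if "p \<in> space M" "piso (edge (T p)) G s" for p s x
      using semigeneric_forth[OF sT sG] that by blast
    show "\<exists>x. piso (edge (T p)) G ((x, y) # s)"
      if "p \<in> space M" "piso (edge (T p)) G s" for p s y
      using semigeneric_back[OF sT sG] that by blast
  qed (rule pisoD(1))
  then obtain f where f_meas: "\<And>x. (\<lambda>p. f p x) \<in> measurable M (count_space UNIV)"
    and f_bij: "\<And>p. p \<in> space M \<Longrightarrow> bij (f p)"
    and f_pair: "\<And>p x y. p \<in> space M \<Longrightarrow>
      \<exists>s. piso (edge (T p)) G s \<and> (x, f p x) \<in> set s \<and> (y, f p y) \<in> set s"
    by blast
  have f_iso: "G (f p x) (f p y) \<longleftrightarrow> edge (T p) x y" if "p \<in> space M" for p x y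
    using f_pair[OF that, of x y] pisoD(2) by metis
  define g where "g p = inv (f p)" for p
  have gf [simp]: "g p (f p x) = x" and fg [simp]: "f p (g p n) = n" if "p \<in> space M" for p x n
    using f_bij[OF that] by (simp_all add: g_def bij_is_inj bij_is_surj surj_f_inv_f)
  \<comment> \<open>The conditions \<open>g p n = x\<close> and \<open>f p x = n\<close> are the
    same.\<close>
  have g_meas: "(\<lambda>p. g p n) \<in> measurable M (count_space UNIV)" for n
  proof (subst measurable_count_space_eq2_countable, safe)
    fix x
    have "(\<lambda>p. g p n) -` {x} \<inter> space M = (\<lambda>p. f p x) -` {n} \<inter> space M"
      using gf fg by auto
    also have "\<dots> \<in> sets M" by (rule measurable_sets[OF f_meas]) simp
    finally show "(\<lambda>p. g p n) -` {x} \<inter> space M \<in> sets M" .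
  qed auto
  have G_g: "G n m \<longleftrightarrow> edge (T p) (g p n) (g p m)" if "p \<in> space M" for p n m
    using f_iso[OF that, of "g p n" "g p m"] that by simp
  define \<phi> where "\<phi> p n = f p (act 1 id (g p n))" for p n
  have "(\<lambda>p. \<phi> p n) \<in> measurable M (count_space UNIV)" for n
    unfolding \<phi>_def
    by (rule measurable_compose_countable[OF f_meas]) (rule measurable_compose[OF g_meas], simp)
  moreover have "automorphism G (\<phi> p)" if p: "p \<in> space M" for p
    unfolding automorphism_def
  proof (intro conjI allI)
    have "bij (g p)" unfolding g_def by (rule bij_imp_bij_inv[OF f_bij[OF p]])
    then have "bij (f p \<circ> (act 1 id \<circ> g p))"
      by (intro bij_comp f_bij[OF p] bij_act bij_id)
    moreover have "\<phi> p = f p \<circ> (act 1 id \<circ> g p)" by (simp add: \<phi>_def fun_eq_iff)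
    ultimately show "bij (\<phi> p)" by simp
    show "G n m \<longleftrightarrow> G (\<phi> p n) (\<phi> p m)" for n m
      unfolding \<phi>_def f_iso[OF p] G_g[OF p, of n m]
      by (rule edge_act[symmetric]) auto
  qed
  ultimately have "\<phi> \<in> measurable M (Aut_space G)" by (rule measurable_Aut_space[rotated])
  moreover have "(\<exists>\<tau>. bij \<tau> \<and> (\<forall>x y. T p x y \<longleftrightarrow> T q (\<tau> x) (\<tau> y))) \<longleftrightarrow> conjugate G (\<phi> p) (\<phi> q)"
    if p: "p \<in> space M" and q: "q \<in> space M" for p q
  proof
    assume "\<exists>\<tau>. bij \<tau> \<and> (\<forall>x y. T p x y \<longleftrightarrow> T q (\<tau> x) (\<tau> y))"
    then obtain \<tau> where \<tau>: "bij \<tau>" "\<And>x y. T p x y \<longleftrightarrow> T q (\<tau> x) (\<tau> y)" by blast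
    \<comment> \<open>The maps \<open>act 0 \<tau>\<close> and \<open>act 1 id\<close> commute by
      \<open>act_act\<close>, so this map conjugates one transported shift to the other.\<close>
    define \<alpha> where "\<alpha> n = f q (act 0 \<tau> (g p n))" for n
    have "bij (g p)" unfolding g_def by (rule bij_imp_bij_inv[OF f_bij[OF p]])
    then have "bij (f q \<circ> (act 0 \<tau> \<circ> g p))"
      by (intro bij_comp f_bij[OF q] bij_act \<tau>(1))
    moreover have "\<alpha> = f q \<circ> (act 0 \<tau> \<circ> g p)" by (simp add: \<alpha>_def fun_eq_iff)
    ultimately have bij: "bij \<alpha>" by simp
    moreover have "G n m \<longleftrightarrow> G (\<alpha> n) (\<alpha> m)" for n m
      unfolding \<alpha>_def f_iso[OF q] G_g[OF p, of n m]
      by (rule edge_act[symmetric]) (use \<tau> in auto)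
    ultimately have "automorphism G \<alpha>" by (simp add: automorphism_def)
    moreover have "\<alpha> (\<phi> p n) = \<phi> q (\<alpha> n)" for n
      using p q by (simp add: \<alpha>_def \<phi>_def act_act)
    then have "\<alpha> \<circ> \<phi> p \<circ> inv \<alpha> = \<phi> q"
      using bij by (auto simp: fun_eq_iff bij_is_surj surj_f_inv_f)
    ultimately show "conjugate G (\<phi> p) (\<phi> q)" unfolding conjugate_def by blast
  next
    assume "conjugate G (\<phi> p) (\<phi> q)"
    then obtain \<alpha> where \<alpha>: "automorphism G \<alpha>" "\<alpha> \<circ> \<phi> p \<circ> inv \<alpha> = \<phi> q"
      unfolding conjugate_def by blast
    have bij: "bij \<alpha>" using \<alpha>(1) by (simp add: automorphism_def)
    have comm: "\<phi> q (\<alpha> n) = \<alpha> (\<phi> p n)" for n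
      unfolding \<alpha>(2)[symmetric] using bij by (simp add: bij_is_inj)
    define \<beta> where "\<beta> x = g q (\<alpha> (f p x))" for x
    have \<beta>_edge: "edge (T p) x y \<longleftrightarrow> edge (T q) (\<beta> x) (\<beta> y)" for x y
      using \<alpha>(1) f_iso[OF p] G_g[OF q] unfolding automorphism_def \<beta>_def by metis
    have "bij (g q)" unfolding g_def by (rule bij_imp_bij_inv[OF f_bij[OF q]])
    then have "bij (g q \<circ> (\<alpha> \<circ> f p))" by (intro bij_comp f_bij[OF p] bij)
    moreover have "\<beta> = g q \<circ> (\<alpha> \<circ> f p)" by (simp add: \<beta>_def fun_eq_iff)
    ultimately have \<beta>_bij: "bij \<beta>" by simp
    have "\<beta> (act 1 id x) = act 1 id (\<beta> x)" for x
    proof -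
      have "\<alpha> (f p (act 1 id x)) = \<alpha> (\<phi> p (f p x))" using p by (simp add: \<phi>_def)
      also have "\<dots> = f q (act 1 id (\<beta> x))" unfolding comm[symmetric] by (simp add: \<phi>_def \<beta>_def)
      finally show ?thesis using q by (simp add: \<beta>_def)
    qed
    \<comment> \<open>Commuting with the shift, \<open>\<beta>\<close> preserves its fixed points,
      which are the base vertices.\<close>
    then have fixed: "\<beta> x \<in> range Base \<longleftrightarrow> x \<in> range Base" for x
      unfolding act_1_fixed[symmetric] using \<beta>_bij by (metis bij_is_inj injD)
    then have "\<forall>b. \<exists>b'. \<beta> (Base b) = Base b'" by blast
    then obtain \<tau> where \<tau>: "\<And>b. \<beta> (Base b) = Base (\<tau> b)" by metis
    have "inj \<tau>"
      using \<tau> \<beta>_bij by (metis bij_is_inj injD injI vx.inject(1))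
    moreover have "surj \<tau>"
      unfolding surj_def
    proof
      fix b'
      obtain x where x: "\<beta> x = Base b'" using \<beta>_bij by (metis bij_pointE)
      then obtain b where "x = Base b" using fixed[of x] by auto
      then show "\<exists>b. b' = \<tau> b" using x \<tau> by auto
    qed
    moreover have "T p x y \<longleftrightarrow> T q (\<tau> x) (\<tau> y)" for x y
      using \<beta>_edge[of "Base x" "Base y"] unfolding \<tau> by (simp add: edge_Base T p q)
    ultimately show "\<exists>\<tau>. bij \<tau> \<and> (\<forall>x y. T p x y \<longleftrightarrow> T q (\<tau> x) (\<tau> y))"
      unfolding bij_def by blast
  qed
  ultimately show ?thesis unfolding borel_reducible_def by blast
qed

section \<open>A generic coloured tournament\<close>

definition colour :: "nat \<Rightarrow> nat" where
  "colour n = fst (prod_decode n)"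

definition below :: "nat \<Rightarrow> nat set" where
  "below n = set (list_decode (snd (prod_decode n)))"

text \<open>Every number codes a colour and a finite set. The in-neighbours of a number among the
  smaller ones are read off its set, so every finite pattern is realised in every colour.\<close>

definition rado :: "nat \<Rightarrow> nat \<Rightarrow> bool" where
  "rado p q \<longleftrightarrow> (if p < q then p \<in> below q else q < p \<and> q \<notin> below p)"

lemma tournament_rado: "tournament rado"
  by (auto simp: tournament_def rado_def)

lemma surj_colour: "surj colour"
  by (rule surjI[where f = "\<lambda>n. prod_encode (n, 0)"]) (simp add: colour_def)

lemma rado_extension:
  assumes "finite D"
  shows "\<exists>y. y \<notin> D \<and> colour y = k \<and> (\<forall>a\<in>D. (rado a y \<longleftrightarrow> Q a) \<and> (rado y a \<longleftrightarrow> \<not> Q a))"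
proof -
  obtain xs where xs: "set xs = {a \<in> D. Q a}" using finite_list[of "{a \<in> D. Q a}"] assms by auto
  obtain N where N: "\<And>a. a \<in> D \<Longrightarrow> a < N" using assms finite_nat_set_iff_bounded by auto
  \<comment> \<open>Listing the bound \<open>N\<close> as well pushes \<open>y\<close> above all of
    \<open>D\<close>, and affects no edge to \<open>D\<close> because \<open>N\<close> is not in
    \<open>D\<close>.\<close>
  define y where "y = prod_encode (k, list_encode (N # xs))"
  have "N \<le> list_encode (N # xs)" by (simp add: le_SucI le_prod_encode_1)
  also have "\<dots> \<le> y" unfolding y_def by (rule le_prod_encode_2)
  finally have less: "a < y" if "a \<in> D" for a using N[OF that] by simp
  have "colour y = k" "below y = insert N {a \<in> D. Q a}"
    by (simp_all add: colour_def below_def y_def xs del: list_encode.simps)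
  moreover have "y \<notin> D" using less by auto
  moreover have "(rado a y \<longleftrightarrow> Q a) \<and> (rado y a \<longleftrightarrow> \<not> Q a)" if "a \<in> D" for a
    using less[OF that] N[OF that] that calculation(2) by (auto simp: rado_def)
  ultimately show ?thesis by blast
qed

section \<open>Lifting permutations of the colours\<close>

definition cpiso :: "(nat \<Rightarrow> nat) \<Rightarrow> (nat \<times> nat) list \<Rightarrow> bool" where
  "cpiso \<pi> s \<longleftrightarrow> piso rado rado s \<and> (\<forall>(x, y) \<in> set s. colour y = \<pi> (colour x))"

lemma cpiso_forth:
  assumes "cpiso \<pi> s"
  shows "\<exists>y. cpiso \<pi> ((x, y) # s)"
proof (cases "x \<in> fst ` set s")
  case True
  then obtain y where "(x, y) \<in> set s" by auto
  then have eq: "set ((x, y) # s) = set s" by auto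
  have "cpiso \<pi> ((x, y) # s)" using assms unfolding cpiso_def piso_def eq .
  then show ?thesis ..
next
  case False
  have s: "piso rado rado s" using assms by (simp add: cpiso_def)
  define Q where "Q y \<longleftrightarrow> (\<exists>x'. (x', y) \<in> set s \<and> rado x' x)" for y
  have Q: "Q b \<longleftrightarrow> rado a x" if "(a, b) \<in> set s" for a b
    using that pisoD(1)[OF s] unfolding Q_def by blast
  have flip: "rado b a \<longleftrightarrow> \<not> rado a b" if "a \<noteq> b" for a b
    using tournament_rado that unfolding tournament_def by blast
  have irr: "\<not> rado a a" for a by (simp add: rado_def)
  obtain y where y: "y \<notin> snd ` set s" "colour y = \<pi> (colour x)"
    "\<And>a. a \<in> snd ` set s \<Longrightarrow> (rado a y \<longleftrightarrow> Q a) \<and> (rado y a \<longleftrightarrow> \<not> Q a)"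
    using rado_extension[of "snd ` set s" "\<pi> (colour x)" Q] by blast
  have "piso rado rado ((x, y) # s)"
  proof (rule piso_Cons[OF s irr irr])
    fix x' y' assume xy: "(x', y') \<in> set s"
    then have "x' \<noteq> x" "y' \<in> snd ` set s" using False by force+
    then show "x \<noteq> x' \<and> y \<noteq> y' \<and> (rado x x' \<longleftrightarrow> rado y y') \<and> (rado x' x \<longleftrightarrow> rado y' y)"
      using y(1) y(3)[of y'] Q[OF xy] flip[of x' x] by auto
  qed
  then have "cpiso \<pi> ((x, y) # s)" using assms y(2) by (simp add: cpiso_def)
  then show ?thesis ..
qed

lemma cpiso_back:
  assumes "bij \<pi>" "cpiso \<pi> s"
  shows "\<exists>x. cpiso \<pi> ((x, y) # s)"
proof -
  have swap: "cpiso (inv \<pi>) (map prod.swap s) \<longleftrightarrow> cpiso \<pi> s" for s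
    using assms(1) bij_inv_eq_iff[OF assms(1)]
    unfolding cpiso_def piso_swap by (fastforce simp: eq_commute)
  obtain x where "cpiso (inv \<pi>) (map prod.swap ((x, y) # s))"
    using cpiso_forth[of "inv \<pi>" "map prod.swap s" y] swap[of s] assms(2) by auto
  then show ?thesis unfolding swap by blast
qed

lemma rado_lift:
  assumes "bij \<pi>"
  shows "\<exists>\<alpha>. bij \<alpha> \<and> (\<forall>x. colour (\<alpha> x) = \<pi> (colour x)) \<and> (\<forall>x y. rado x y \<longleftrightarrow> rado (\<alpha> x) (\<alpha> y))"
proof -
  \<comment> \<open>The parameter space is a single point, so the measurability clause is
    void.\<close>
  have "\<exists>f. (\<forall>x. (\<lambda>p. f p x) \<in> measurable (count_space (UNIV :: unit set)) (count_space UNIV)) \<and>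
    (\<forall>p\<in>space (count_space UNIV). bij (f p) \<and>
      (\<forall>x y. \<exists>s. cpiso \<pi> s \<and> (x, f p x) \<in> set s \<and> (y, f p y) \<in> set s))"
  proof (rule measurable_back_and_forth)
    show "cpiso \<pi> []" by (simp add: cpiso_def piso_def)
    show "x = x' \<longleftrightarrow> y = y'" if "cpiso \<pi> s" "(x, y) \<in> set s" "(x', y') \<in> set s" for s x y x' y'
      using that pisoD(1) unfolding cpiso_def by metis
  qed (use cpiso_forth cpiso_back[OF assms] in simp_all)
  then obtain \<alpha> where "bij \<alpha>"
    and pair: "\<And>x y. \<exists>s. cpiso \<pi> s \<and> (x, \<alpha> x) \<in> set s \<and> (y, \<alpha> y) \<in> set s"
    by auto
  moreover have "colour (\<alpha> x) = \<pi> (colour x)" for x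
    using pair[of x x] unfolding cpiso_def by fastforce
  moreover have "rado x y \<longleftrightarrow> rado (\<alpha> x) (\<alpha> y)" for x y
    using pair[of x y] pisoD(2) unfolding cpiso_def by metis
  ultimately show ?thesis by blast
qed

section \<open>Coding structures by tournaments\<close>

text \<open>The markers \<open>Mk k\<close> form a chain of type \<open>\<omega>\<close>, hence are rigid, and each of them codes
  a unary predicate on points and tuples.  \<open>Bottom\<close> is the only vertex with a unique
  out-neighbour, namely \<open>Divider\<close>, which separates the markers from the points and tuples.
  Points carry the generic tournament; a point stands for its colour, so that an isomorphism of
  structures lifts to an isomorphism of the tournaments.\<close>

datatype gad = Bottom | Divider | Mk nat | Pt nat | Tp "nat list"

instance gad :: countable by countable_datatype

text \<open>Marker 0 tells points from tuples, and marker 1 detects equality of colours through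
  pairs. The remaining markers alternate between lengths of tuples and the relations of
  \<open>M\<close> pulled back along \<open>colour\<close>.\<close>

fun pred_on :: "(nat \<times> nat list \<Rightarrow> bool) \<Rightarrow> nat \<Rightarrow> gad \<Rightarrow> bool" where
  "pred_on M 0 (Pt q) = True"
| "pred_on M (Suc 0) (Tp xs) = (\<exists>p q. xs = [p, q] \<and> colour p = colour q)"
| "pred_on M (Suc (Suc k)) (Tp xs) =
     (if even k then length xs = k div 2 else M (k div 2, map colour xs))"
| "pred_on M _ _ = False"

fun lex_rado :: "nat list \<Rightarrow> nat list \<Rightarrow> bool" where
  "lex_rado (x # xs) (y # ys) = (if x = y then lex_rado xs ys else rado x y)"
| "lex_rado _ _ = False"

text \<open>By default edges go from points to tuples and from shorter to longer tuples. Against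
  this, a nonempty tuple points to its first entry and to its tail, and these two determine it among
  the tuples of its length.\<close>

fun gadget :: "(nat \<times> nat list \<Rightarrow> bool) \<Rightarrow> gad \<Rightarrow> gad \<Rightarrow> bool" where
  "gadget M Bottom y = (y = Divider)"
| "gadget M Divider Bottom = False"
| "gadget M x Bottom = True"
| "gadget M Divider (Pt q) = True"
| "gadget M Divider (Tp ys) = True"
| "gadget M Divider y = False"
| "gadget M (Mk i) Divider = True"
| "gadget M x Divider = False"
| "gadget M (Mk i) (Mk j) = (i < j)"
| "gadget M (Mk i) y = (\<not> pred_on M i y)"
| "gadget M x (Mk j) = pred_on M j x"
| "gadget M (Pt p) (Pt q) = rado p q"
| "gadget M (Pt p) (Tp ys) = (\<not> (\<exists>zs. ys = p # zs))"
| "gadget M (Tp xs) (Pt q) = (\<exists>zs. xs = q # zs)"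
| "gadget M (Tp xs) (Tp ys) =
     (if length xs = length ys then lex_rado xs ys
      else if length xs < length ys then \<not> (\<exists>z. ys = z # xs) else (\<exists>z. xs = z # ys))"

lemma lex_rado_flip:
  "length xs = length ys \<Longrightarrow> xs \<noteq> ys \<Longrightarrow> lex_rado ys xs \<longleftrightarrow> \<not> lex_rado xs ys"
proof (induction xs ys rule: lex_rado.induct)
  case (1 x xs y ys)
  have "x \<noteq> y \<Longrightarrow> rado y x \<longleftrightarrow> \<not> rado x y" using tournament_rado unfolding tournament_def by blast
  then show ?case using 1 by auto
qed auto

lemma lex_rado_irrefl: "\<not> lex_rado xs xs"
  by (induction xs) auto

lemma tournament_gadget: "tournament (gadget M)"
  unfolding tournament_def
proof (intro conjI allI impI)
  show "\<not> gadget M x x" for x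
    by (cases x) (auto simp: rado_def lex_rado_irrefl)
  fix x y :: gad assume "x \<noteq> y"
  consider p q where "x = Pt p" "y = Pt q" | xs ys where "x = Tp xs" "y = Tp ys"
    | "\<not> (\<exists>p q. x = Pt p \<and> y = Pt q)" "\<not> (\<exists>xs ys. x = Tp xs \<and> y = Tp ys)" by blast
  then show "gadget M y x \<longleftrightarrow> \<not> gadget M x y"
  proof cases
    case (1 p q)
    then have "p \<noteq> q" using \<open>x \<noteq> y\<close> by simp
    then have "rado q p \<longleftrightarrow> \<not> rado p q" using tournament_rado unfolding tournament_def by blast
    then show ?thesis by (simp add: 1)
  next
    case (2 xs ys)
    then show ?thesis using \<open>x \<noteq> y\<close> lex_rado_flip[of xs ys] by auto
  next
    case 3
    then show ?thesis using \<open>x \<noteq> y\<close> by (cases x; cases y) (simp_all add: not_less_iff_gr_or_eq)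
  qed
qed

lemma measurable_gadget:
  assumes "\<And>z. (\<lambda>p. M p z) \<in> measurable N (count_space UNIV)"
  shows "(\<lambda>p. gadget (M p) x y) \<in> measurable N (count_space UNIV)"
proof -
  have *: "(\<lambda>p. pred_on (M p) k x) \<in> measurable N (count_space UNIV)" for k x
    using assms by (cases "(undefined :: nat \<times> nat list \<Rightarrow> bool, k, x)" rule: pred_on.cases) simp_all
  then show ?thesis by (cases x; cases y) simp_all
qed

section \<open>Isomorphism of structures against isomorphism of their tournaments\<close>

lemma lex_rado_map:
  assumes "inj \<alpha>" "\<And>x y. rado x y \<longleftrightarrow> rado (\<alpha> x) (\<alpha> y)"
  shows "lex_rado (map \<alpha> xs) (map \<alpha> ys) \<longleftrightarrow> lex_rado xs ys"
  using assms by (induction xs ys rule: lex_rado.induct) (auto simp: inj_eq)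

text \<open>The isomorphism permutes colours and lifts to an automorphism of \<open>rado\<close>.
  Applied to points and to the entries of tuples, the lift carries the pulled back relations of
  \<open>M\<close> to those of \<open>N\<close>.\<close>

lemma gadget_iso_if_str_iso:
  assumes "str_iso M N"
  shows "\<exists>\<tau>. bij \<tau> \<and> (\<forall>x y. gadget M x y \<longleftrightarrow> gadget N (\<tau> x) (\<tau> y))"
proof -
  obtain \<pi> where \<pi>: "bij \<pi>" "\<And>i xs. M (i, xs) \<longleftrightarrow> N (i, map \<pi> xs)"
    using assms unfolding str_iso_def by blast
  obtain \<alpha> where \<alpha>: "bij \<alpha>" "\<And>x. colour (\<alpha> x) = \<pi> (colour x)"
    "\<And>x y. rado x y \<longleftrightarrow> rado (\<alpha> x) (\<alpha> y)"
    using rado_lift[OF \<pi>(1)] by blast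
  define lift where "lift \<gamma> x = (case x of Pt q \<Rightarrow> Pt (\<gamma> q) | Tp xs \<Rightarrow> Tp (map \<gamma> xs) | _ \<Rightarrow> x)"
    for \<gamma> x
  have lift_simps [simp]: "lift \<gamma> Bottom = Bottom" "lift \<gamma> Divider = Divider" "lift \<gamma> (Mk k) = Mk k"
    "lift \<gamma> (Pt q) = Pt (\<gamma> q)" "lift \<gamma> (Tp xs) = Tp (map \<gamma> xs)" for \<gamma> k q xs
    by (simp_all add: lift_def)
  have inj: "\<alpha> x = \<alpha> y \<longleftrightarrow> x = y" for x y using \<alpha>(1) by (simp add: bij_is_inj inj_eq)
  have comp: "lift \<gamma> (lift \<delta> x) = lift (\<gamma> \<circ> \<delta>) x" for \<gamma> \<delta> x by (cases x) auto
  have id: "lift id x = x" for x by (cases x) auto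
  have "bij (lift \<alpha>)"
  proof (rule o_bij)
    show "lift (inv \<alpha>) \<circ> lift \<alpha> = id"
      using \<alpha>(1) by (simp add: fun_eq_iff comp id bij_is_inj)
    show "lift \<alpha> \<circ> lift (inv \<alpha>) = id"
      using \<alpha>(1) by (simp add: fun_eq_iff comp id bij_is_surj surj_iff[THEN iffD1])
  qed
  moreover have "gadget M x y \<longleftrightarrow> gadget N (lift \<alpha> x) (lift \<alpha> y)" for x y
  proof -
    have col: "map colour (map \<alpha> xs) = map \<pi> (map colour xs)" for xs by (simp add: \<alpha>(2))
    have "colour (\<alpha> p) = colour (\<alpha> q) \<longleftrightarrow> colour p = colour q" for p q
      using \<pi>(1) by (simp add: \<alpha>(2) bij_is_inj inj_eq)
    then have "(\<exists>p q. map \<alpha> xs = [p, q] \<and> colour p = colour q) \<longleftrightarrow>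
        (\<exists>p q. xs = [p, q] \<and> colour p = colour q)" for xs
      by (auto simp: map_eq_Cons_conv)
    then have pred: "pred_on N k (lift \<alpha> x) \<longleftrightarrow> pred_on M k x" for k x
      by (cases "(M, k, x)" rule: pred_on.cases) (simp_all add: \<pi>(2) \<alpha>(2) comp_def)
    have ex1: "(\<exists>zs. map \<alpha> ys = \<alpha> p # zs) \<longleftrightarrow> (\<exists>zs. ys = p # zs)" for ys p
      by (cases ys) (auto simp: inj)
    have ex2: "(\<exists>z. map \<alpha> ys = z # map \<alpha> xs) \<longleftrightarrow> (\<exists>z. ys = z # xs)" for xs ys
      by (cases ys) (auto simp: inj_map_eq_map[OF bij_is_inj[OF \<alpha>(1)]])
    show ?thesis
      using pred[of _ x] pred[of _ y]
      by (cases x; cases y)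
        (simp_all add: ex1 ex2 lex_rado_map[OF bij_is_inj[OF \<alpha>(1)] \<alpha>(3)] flip: \<alpha>(3))
  qed
  ultimately show ?thesis by blast
qed

lemma gadget_unique_out: "(\<exists>!y. gadget M x y) \<longleftrightarrow> x = Bottom"
proof
  assume *: "\<exists>!y. gadget M x y"
  have contra: False if "gadget M x y" "gadget M x z" "y \<noteq> z" for y z using * that by blast
  show "x = Bottom"
  proof (cases x)
    case Divider
    then show ?thesis using contra[of "Pt 0" "Pt 1"] by simp
  next
    case (Mk k)
    then show ?thesis using contra[of Bottom Divider] by simp
  next
    case (Pt q)
    then show ?thesis using contra[of Bottom "Mk 0"] by simp
  next
    case (Tp xs)
    \<comment> \<open>The second out-neighbour is the marker that codes the length of
      \<open>xs\<close>.\<close>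
    then show ?thesis using contra[of Bottom "Mk (Suc (Suc (2 * length xs)))"] by simp
  qed
qed auto

text \<open>The vertices are recognised in turn: \<open>Bottom\<close> by its unique out-neighbour,
  \<open>Divider\<close> as that neighbour, the markers by rigidity, and then points and tuples by
  the markers. The induced map on points respects equality of colours and so descends to
  colours.\<close>

lemma str_iso_if_gadget_iso:
  assumes bij: "bij \<tau>" and \<tau>: "\<And>x y. gadget M x y \<longleftrightarrow> gadget N (\<tau> x) (\<tau> y)"
  shows "str_iso M N"
proof -
  have inj: "\<tau> x = \<tau> y \<longleftrightarrow> x = y" for x y using bij by (simp add: bij_is_inj inj_eq)
  have surj: "\<exists>x. y = \<tau> x" for y using bij unfolding bij_def surj_def by blast
  have "\<exists>!y. gadget N (\<tau> Bottom) y"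
  proof (rule ex1I)
    show "gadget N (\<tau> Bottom) (\<tau> Divider)" by (simp flip: \<tau>)
    fix y assume y: "gadget N (\<tau> Bottom) y"
    obtain x where "y = \<tau> x" using surj by blast
    then show "y = \<tau> Divider" using y by (simp flip: \<tau>)
  qed
  then have bot: "\<tau> Bottom = Bottom" by (simp add: gadget_unique_out)
  have "gadget N (\<tau> Bottom) (\<tau> Divider)" by (simp flip: \<tau>)
  then have dv: "\<tau> Divider = Divider" by (simp add: bot)
  have marker: "x \<in> range Mk \<longleftrightarrow> x \<noteq> Bottom \<and> gadget L x Divider" for x L
    by (cases x) auto
  have mk: "\<tau> x \<in> range Mk \<longleftrightarrow> x \<in> range Mk" for x
    unfolding marker[of x M] marker[of "\<tau> x" N] using \<tau>[of x Divider] inj[of x Bottom]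
    by (simp add: bot dv)
  then have "\<forall>k. \<exists>k'. \<tau> (Mk k) = Mk k'" by blast
  then obtain \<mu> where \<mu>: "\<And>k. \<tau> (Mk k) = Mk (\<mu> k)" by metis
  have "strict_mono \<mu>"
    using \<tau>[of "Mk _" "Mk _"] by (auto simp: \<mu> strict_mono_def)
  moreover have "surj \<mu>"
    unfolding surj_def
  proof
    fix k'
    obtain x where x: "Mk k' = \<tau> x" using surj by blast
    then have "x \<in> range Mk" using mk[of x] by (metis rangeI)
    then obtain k where "x = Mk k" by blast
    then show "\<exists>k. k' = \<mu> k" using x by (auto simp: \<mu>)
  qed
  \<comment> \<open>A strictly increasing surjection of the natural numbers is the identity, so
    every marker is fixed.\<close>
  ultimately have "\<mu> k = k" for k
  proof (induction k rule: less_induct)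
    case (less k)
    obtain j where j: "k = \<mu> j" using less.prems(2) by (meson surjE)
    have "j \<le> k" using j less.prems(1) by (simp add: strict_mono_imp_increasing)
    moreover have "\<not> j < k"
    proof
      assume "j < k"
      moreover from this have "\<mu> j = j" using less.IH less.prems by blast
      ultimately show False using j by simp
    qed
    ultimately show ?case using j by simp
  qed
  then have mk_id: "\<tau> (Mk k) = Mk k" for k by (simp add: \<mu>)
  have upper: "x \<in> range Pt \<union> range Tp \<longleftrightarrow> gadget L Divider x" for x L
    by (cases x) auto
  have up: "\<tau> x \<in> range Pt \<union> range Tp \<longleftrightarrow> x \<in> range Pt \<union> range Tp" for x
    unfolding upper[of x M] upper[of "\<tau> x" N] using \<tau>[of Divider x] by (simp add: dv)
  have gp: "gadget L x (Mk k) \<longleftrightarrow> pred_on L k x" if "x \<in> range Pt \<union> range Tp" for L x k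
    using that by auto
  have pred: "pred_on M k x \<longleftrightarrow> pred_on N k (\<tau> x)" if "x \<in> range Pt \<union> range Tp" for x k
    using \<tau>[of x "Mk k"] gp[OF that] gp[of "\<tau> x"] up[of x] that unfolding mk_id by simp
  have pt: "x \<in> range Pt \<longleftrightarrow> pred_on L 0 x" for x L by (cases x) auto
  have pts: "\<tau> x \<in> range Pt \<longleftrightarrow> x \<in> range Pt" for x
    using up[of x] pred[of x 0] pt[of x M] pt[of "\<tau> x" N] by blast
  then have "\<forall>q. \<exists>q'. \<tau> (Pt q) = Pt q'" by blast
  then obtain \<beta> where \<beta>: "\<And>q. \<tau> (Pt q) = Pt (\<beta> q)" by metis
  have surj_\<beta>: "\<exists>q. q' = \<beta> q" for q'
  proof -
    obtain x where x: "Pt q' = \<tau> x" using surj by blast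
    then have "x \<in> range Pt" using pts[of x] by (metis rangeI)
    then obtain q where "x = Pt q" by blast
    then show ?thesis using x by (auto simp: \<beta>)
  qed
  have tuple: "\<exists>ys. \<tau> (Tp xs) = Tp ys \<and> length ys = length xs" for xs
  proof -
    have "\<tau> (Tp xs) \<in> range Tp" using up[of "Tp xs"] pts[of "Tp xs"] by auto
    then obtain ys where ys: "\<tau> (Tp xs) = Tp ys" by blast
    show ?thesis
      using pred[of "Tp xs" "Suc (Suc (2 * length xs))"] ys by auto
  qed
  \<comment> \<open>The length is kept by the markers, the head is seen by an edge to a point, and
    the tail by an edge to a tuple whose image is known by induction.\<close>
  have tp: "\<tau> (Tp xs) = Tp (map \<beta> xs)" for xs
  proof (induction xs)
    case Nil
    then show ?case using tuple[of "[]"] by auto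
  next
    case (Cons x xs)
    obtain ys where ys: "\<tau> (Tp (x # xs)) = Tp ys" "length ys = Suc (length xs)"
      using tuple[of "x # xs"] by auto
    have "gadget N (Tp ys) (Pt (\<beta> x))" using \<tau>[of "Tp (x # xs)" "Pt x"] by (simp add: ys \<beta>)
    moreover have "gadget N (Tp ys) (Tp (map \<beta> xs))"
      using \<tau>[of "Tp (x # xs)" "Tp xs"] by (simp add: ys Cons.IH)
    ultimately show ?case using ys by auto
  qed
  have col: "colour (\<beta> p) = colour (\<beta> q) \<longleftrightarrow> colour p = colour q" for p q
    using pred[of "Tp [p, q]" "Suc 0"] by (simp add: tp)
  have rel: "M (i, map colour xs) \<longleftrightarrow> N (i, map colour (map \<beta> xs))" for i xs
    using pred[of "Tp xs" "Suc (Suc (Suc (2 * i)))"] by (simp add: tp)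
  \<comment> \<open>By \<open>col\<close> the value depends only on the colour, not on the point
    chosen by \<open>inv colour\<close>.\<close>
  define \<pi> where "\<pi> = (\<lambda>k. colour (\<beta> (inv colour k)))"
  have \<pi>: "\<pi> (colour q) = colour (\<beta> q)" for q
    unfolding \<pi>_def col by (simp add: surj_f_inv_f[OF surj_colour])
  have "bij \<pi>"
  proof (rule bijI')
    show "\<pi> x = \<pi> y \<longleftrightarrow> x = y" for x y
      unfolding \<pi>_def col by (simp add: surj_f_inv_f[OF surj_colour])
    fix k
    obtain q' where "k = colour q'" using surj_colour by (meson surjE)
    moreover obtain q where "q' = \<beta> q" using surj_\<beta> by blast
    ultimately have "k = \<pi> (colour q)" by (simp add: \<pi>)
    then show "\<exists>x. k = \<pi> x" ..
  qed
  moreover have "M (i, xs) \<longleftrightarrow> N (i, map \<pi> xs)" for i xs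
  proof -
    have "xs = map colour (map (inv colour) xs)"
      by (simp add: surj_iff[THEN iffD1, OF surj_colour])
    then show ?thesis using rel[of i "map (inv colour) xs"] by (simp add: \<pi>_def comp_def)
  qed
  ultimately show ?thesis unfolding str_iso_def by blast
qed

section \<open>Conjugacy as isomorphism of structures, and Borel completeness\<close>

lemma measurable_coordinate:
  "(\<lambda>R. R z) \<in> measurable (restrict_space (Pi\<^sub>M UNIV (\<lambda>_. count_space UNIV)) A) (count_space UNIV)"
  by (intro measurable_restrict_space1 measurable_component_singleton) simp

lemma borel_reducible_cong:
  assumes "borel_reducible M E N F" "\<And>x y. x \<in> space M \<Longrightarrow> y \<in> space M \<Longrightarrow> E x y \<longleftrightarrow> E' x y"
  shows "borel_reducible M E' N F"
proof -
  obtain f where f: "f \<in> measurable M N"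
    "\<And>x y. x \<in> space M \<Longrightarrow> y \<in> space M \<Longrightarrow> E x y \<longleftrightarrow> F (f x) (f y)"
    using assms(1) unfolding borel_reducible_def by blast
  show ?thesis
    unfolding borel_reducible_def by (intro bexI[OF _ f(1)] ballI) (simp add: f(2) flip: assms(2))
qed

lemma sets_structures: "structures ar \<in> sets str_measure"
proof -
  have "structures ar = (\<Inter>z. {M \<in> space str_measure. M z \<longrightarrow> length (snd z) = ar (fst z)})"
    by (auto simp: structures_def str_measure_def space_PiM)
  also have "\<dots> \<in> sets str_measure"
  proof (rule sets.countable_INT'')
    fix z :: "nat \<times> nat list"
    have "(\<lambda>M. M z) \<in> measurable str_measure (count_space UNIV)"
      unfolding str_measure_def by (rule measurable_component_singleton) simp
    then show "{M \<in> space str_measure. M z \<longrightarrow> length (snd z) = ar (fst z)} \<in> sets str_measure"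
      by measurable
  next
    show "UNIV \<in> sets str_measure"
      using sets.top[of str_measure] by (simp add: str_measure_def space_PiM)
  qed simp
  finally show ?thesis .
qed

text \<open>Symbol 0 carries the digraph and symbol 1 the graph of \<open>\<phi>\<close>, so an
  isomorphism between two such structures is an automorphism of \<open>G\<close> that conjugates one
  map to the other.\<close>

definition aut_structure :: "(nat \<Rightarrow> nat \<Rightarrow> bool) \<Rightarrow> (nat \<Rightarrow> nat) \<Rightarrow> nat \<times> nat list \<Rightarrow> bool" where
  "aut_structure G \<phi> z \<longleftrightarrow> (\<exists>x y. snd z = [x, y] \<and> (fst z = 0 \<and> G x y \<or> fst z = 1 \<and> y = \<phi> x))"

lemma str_iso_aut_structure:
  "str_iso (aut_structure G \<phi>) (aut_structure G \<psi>) \<longleftrightarrow> conjugate G \<phi> \<psi>"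
proof
  assume "str_iso (aut_structure G \<phi>) (aut_structure G \<psi>)"
  then obtain \<pi> where \<pi>: "bij \<pi>"
    "\<And>i xs. aut_structure G \<phi> (i, xs) \<longleftrightarrow> aut_structure G \<psi> (i, map \<pi> xs)"
    unfolding str_iso_def by blast
  have "G x y \<longleftrightarrow> G (\<pi> x) (\<pi> y)" for x y
    using \<pi>(2)[of 0 "[x, y]"] by (simp add: aut_structure_def)
  then have "automorphism G \<pi>" using \<pi>(1) by (simp add: automorphism_def)
  moreover have "\<pi> (\<phi> x) = \<psi> (\<pi> x)" for x
    using \<pi>(2)[of 1 "[x, \<phi> x]"] by (simp add: aut_structure_def)
  then have "\<pi> \<circ> \<phi> \<circ> inv \<pi> = \<psi>"
    using \<pi>(1) by (simp add: fun_eq_iff bij_is_surj surj_f_inv_f)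
  ultimately show "conjugate G \<phi> \<psi>" unfolding conjugate_def by blast
next
  assume "conjugate G \<phi> \<psi>"
  then obtain \<alpha> where \<alpha>: "automorphism G \<alpha>" "\<alpha> \<circ> \<phi> \<circ> inv \<alpha> = \<psi>"
    unfolding conjugate_def by blast
  have bij: "bij \<alpha>" and G: "G (\<alpha> x) (\<alpha> y) \<longleftrightarrow> G x y" for x y
    using \<alpha>(1) by (simp_all add: automorphism_def)
  have inj: "\<alpha> x = \<alpha> y \<longleftrightarrow> x = y" for x y using bij by (simp add: bij_is_inj inj_eq)
  have comm: "\<psi> (\<alpha> x) = \<alpha> (\<phi> x)" for x
    unfolding \<alpha>(2)[symmetric] using bij by (simp add: bij_is_inj)
  have "aut_structure G \<phi> (i, xs) \<longleftrightarrow> aut_structure G \<psi> (i, map \<alpha> xs)" for i xs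
    by (auto simp: aut_structure_def map_eq_Cons_conv G comm inj)
  then show "str_iso (aut_structure G \<phi>) (aut_structure G \<psi>)"
    unfolding str_iso_def using bij by blast
qed

lemma measurable_aut_structure:
  "aut_structure G \<in> measurable (Aut_space G) (restrict_space str_measure (structures (\<lambda>_. 2)))"
proof (rule measurable_restrict_space2)
  show "aut_structure G \<in> space (Aut_space G) \<rightarrow> structures (\<lambda>_. 2)"
    by (auto simp: structures_def aut_structure_def)
  show "aut_structure G \<in> measurable (Aut_space G) str_measure"
    unfolding str_measure_def
  proof (rule measurable_PiM_single')
    fix z :: "nat \<times> nat list"
    have [measurable]: "(\<lambda>\<phi>. \<phi> x) \<in> measurable (Aut_space G) (count_space UNIV)" for x
      unfolding Aut_space_def by (rule measurable_coordinate)
    show "(\<lambda>\<phi>. aut_structure G \<phi> z) \<in> measurable (Aut_space G) (count_space UNIV)"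
      unfolding aut_structure_def by measurable
  qed auto
qed

theorem theorem4p2:
  fixes G :: "nat \<Rightarrow> nat \<Rightarrow> bool"
  assumes "semigeneric_limit G"
  shows "borel_reducible LO_space LO_iso (Aut_space G) (conjugate G)
         \<and> borel_complete (Aut_space G) (conjugate G)"
proof
  have "borel_reducible LO_space
      (\<lambda>R S. \<exists>\<tau>. bij \<tau> \<and> (\<forall>x y. R (x, y) \<longleftrightarrow> S (\<tau> x, \<tau> y))) (Aut_space G) (conjugate G)"
  proof (rule tournament_iso_reducible[OF assms, where T = "\<lambda>R x y. R (x, y)"])
    show "(\<lambda>R. R (x, y)) \<in> measurable LO_space (count_space UNIV)" for x y
      unfolding LO_space_def by (rule measurable_coordinate)
    show "tournament (\<lambda>x y. R (x, y))" if "R \<in> space LO_space" for R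
    proof -
      have "R \<in> linear_orders" using that by (simp add: LO_space_def space_restrict_space)
      then show ?thesis unfolding linear_orders_def tournament_def by blast
    qed
  qed
  then show "borel_reducible LO_space LO_iso (Aut_space G) (conjugate G)"
    unfolding LO_iso_def .
  \<comment> \<open>The structures with binary symbols serve as the class to which conjugacy
    reduces.\<close>
  have "structure_class (\<lambda>_. 2) (structures (\<lambda>_. 2))"
    unfolding structure_class_def using sets_structures by blast
  moreover have "borel_reducible (Aut_space G) (conjugate G)
      (restrict_space str_measure (structures (\<lambda>_. 2))) str_iso"
    unfolding borel_reducible_def
  proof (intro bexI[OF _ measurable_aut_structure] ballI)
    show "conjugate G \<phi> \<psi> \<longleftrightarrow> str_iso (aut_structure G \<phi>) (aut_structure G \<psi>)" for \<phi> \<psi>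
      by (simp add: str_iso_aut_structure)
  qed
  \<comment> \<open>Conversely, \<open>gadget\<close> turns isomorphism in any class
    \<open>K\<close> into isomorphism of tournaments, and hence into conjugacy.\<close>
  moreover have "borel_reducible (restrict_space str_measure K) str_iso (Aut_space G) (conjugate G)" for K
  proof (rule borel_reducible_cong)
    show "borel_reducible (restrict_space str_measure K)
      (\<lambda>M N. \<exists>\<tau>. bij \<tau> \<and> (\<forall>x y. gadget M x y \<longleftrightarrow> gadget N (\<tau> x) (\<tau> y))) (Aut_space G) (conjugate G)"
      by (rule tournament_iso_reducible[OF assms measurable_gadget tournament_gadget])
        (unfold str_measure_def, rule measurable_coordinate)
  qed (use gadget_iso_if_str_iso str_iso_if_gadget_iso in blast)
  ultimately show "borel_complete (Aut_space G) (conjugate G)"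
    unfolding borel_complete_def by blast
qed

end
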